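(* Let $C$ be a unicuspidal monomial curve of arithmetic genus $g\geq 4$ over an algebraically closed field $k$, with semigroup $\mathrm{S}$, set of gaps $\mathrm{G}$, and Frobenius number $\gamma$. Let $\mathscr{F}:=\mathcal{O}\langle 1,t^{a_1},\ldots,t^{a_n}\rangle$ with $n\geq 1$ and $0<a_1<\cdots<a_n$ integers. Consider the set $\mathrm{E}:=\bigcup_{i=1}^n(a_i+\mathrm{S})$. Then $$\mathrm{Cliff}(\mathscr{F})=\#\big((\mathrm{G}\setminus\mathrm{E})\cap[1,a_n]\big)-\#\big(\mathrm{S}\cap[1,a_n]\big)+\#\big((\mathrm{E}\setminus\mathrm{S})\cap[a_n+1,\gamma]\big).$$ If $\mathscr{F}$ is invertible, then $$\mathrm{Cliff}(\mathscr{F})=\#\big(\mathrm{G}\cap[1,a_n]\big)-\#\big(\mathrm{S}\cap[1,a_n]\big).$$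
   Context: A monomial curve $C=(1:t^{n_1}:\cdots:t^{n_m})$ is the image of the map $\mathbb{P}^1\to\mathbb{P}^m$, $(s:t)\mapsto(s^{n_m}:s^{n_m-n_1}t^{n_1}:\cdots:s^{n_m-n_{m-1}}t^{n_{m-1}}:t^{n_m})$, $0<n_1<\cdots<n_m$. It is unicuspidal if it has exactly one singular point and this point is unibranch; by convention the singular point is $P=(1:0:\cdots:0)$, so $n_1\geq 2$, and the point at infinity $(0:\cdots:0:1)$ is regular, i.e. $n_m=n_{m-1}+1$. The function field of $C$ is $k(t)$. Let $v$ be the valuation of $k(t)$ at $t=0$ (the point of the normalization over $P$). The semigroup of $C$ is $\mathrm{S}:=v(\mathcal{O}_P)\subset\mathbb{N}$ (values of nonzero elements); its set of gaps is $\mathrm{G}:=\mathbb{N}\setminus\mathrm{S}$ and its Frobenius number $\gamma$ is the largest gap. For $f_1,\ldots,f_n\in k(C)$, $\mathcal{O}\langle f_1,\ldots,f_n\rangle$ is the subsheaf of the constant sheaf of rational functions generated by the $f_i$, with stalks $f_1\mathcal{O}_R+\cdots+f_n\mathcal{O}_R$, $R\in C$. For a torsion-free sheaf $\mathscr{F}$ of rank $1$ on $C$, $\deg(\mathscr{F}):=\chi(\mathscr{F})-\chi(\mathcal{O})$ and the Clifford index of $\mathscr{F}$ is $\mathrm{Cliff}(\mathscr{F}):=\deg(\mathscr{F})-2(h^0(\mathscr{F})-1)$. Intervals denote sets of integers ($[a,b]$ is empty if $a>b$). *)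

theory Defs
  imports
    "HOL-Computational_Algebra.Computational_Algebra"
    "HOL-Library.Poly_Mapping"
    "HOL-Library.Function_Algebras"
begin

text \<open>
  The field \<open>k(t)\<close> is \<^typ>\<open>'k poly fract\<close>.  A point of projective \<open>m\<close>-space is the set of all its
  homogeneous coordinate vectors \<open>(x\<^sub>0, \<dots>, x\<^sub>m)\<close>, extended by \<open>0\<close> beyond the index \<open>m\<close>.  The curves are
  over an algebraically closed field, and only their closed points are used.
\<close>

type_synonym 'k ppoint = "(nat \<Rightarrow> 'k) set"

definition proj_point :: "nat \<Rightarrow> (nat \<Rightarrow> 'k::field) \<Rightarrow> 'k ppoint" where
  "proj_point m x = {y. (\<forall>i>m. y i = 0) \<and> (\<exists>c. c \<noteq> 0 \<and> (\<forall>i\<le>m. y i = c * x i))}"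


section \<open>Homogeneous polynomials\<close>

type_synonym 'k mpol = "(nat \<Rightarrow>\<^sub>0 nat) \<Rightarrow>\<^sub>0 'k"

definition homogeneous :: "nat \<Rightarrow> nat \<Rightarrow> 'k::field mpol \<Rightarrow> bool" where
  "homogeneous m d F \<longleftrightarrow>
     (\<forall>\<mu>\<in>Poly_Mapping.keys F.
        Poly_Mapping.keys \<mu> \<subseteq> {..m} \<and> (\<Sum>i\<in>Poly_Mapping.keys \<mu>. Poly_Mapping.lookup \<mu> i) = d)"

definition mpol_eval ::
    "('k::field \<Rightarrow> 'b::comm_ring_1) \<Rightarrow> (nat \<Rightarrow> 'b) \<Rightarrow> 'k mpol \<Rightarrow> 'b" where
  "mpol_eval h x F =
     (\<Sum>\<mu>\<in>Poly_Mapping.keys F. h (Poly_Mapping.lookup F \<mu>) *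
        (\<Prod>i\<in>Poly_Mapping.keys \<mu>. x i ^ Poly_Mapping.lookup \<mu> i))"

definition nonzero_at :: "'k::field mpol \<Rightarrow> 'k ppoint \<Rightarrow> bool" where
  "nonzero_at G R \<longleftrightarrow> (\<forall>x\<in>R. mpol_eval (\<lambda>c. c) x G \<noteq> 0)"


section \<open>Monomial curves\<close>

text \<open>
  The exponents are \<open>e 1 < \<dots> < e m\<close>; the convention \<open>e 0 = 0\<close> makes the \<open>i\<close>-th coordinate of the
  parametrization equal to \<open>s ^ (e m - e i) * t ^ e i\<close> for all \<open>i \<le> m\<close>.
\<close>

definition monomial_curve :: "nat \<Rightarrow> (nat \<Rightarrow> nat) \<Rightarrow> 'k::field ppoint set" where
  "monomial_curve m e =
     {proj_point m (\<lambda>i. s ^ (e m - e i) * t ^ e i) | s t. (s, t) \<noteq> (0, 0)}"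

definition cusp_point :: "nat \<Rightarrow> 'k::field ppoint" where
  "cusp_point m = proj_point m (\<lambda>i. if i = 0 then 1 else 0)"

definition zariski_open :: "nat \<Rightarrow> (nat \<Rightarrow> nat) \<Rightarrow> 'k::field ppoint set \<Rightarrow> bool" where
  "zariski_open m e U \<longleftrightarrow>
     (\<exists>I. (\<forall>G\<in>I. \<exists>d. homogeneous m d G) \<and> U = {R \<in> monomial_curve m e. \<exists>G\<in>I. nonzero_at G R})"

definition const_kt :: "'k::field \<Rightarrow> 'k poly fract" where
  "const_kt c = to_fract [:c:]"

definition t_pow :: "nat \<Rightarrow> 'k::field poly fract" where
  "t_pow j = to_fract (monom 1 j)"

text \<open>
  The substitution \<open>x\<^sub>i \<mapsto> t ^ e i\<close> (the parametrization at \<open>(s:t) = (1:t)\<close>), through which the rational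
  functions on the curve become elements of \<open>k(t)\<close>.
\<close>

definition pullback :: "(nat \<Rightarrow> nat) \<Rightarrow> 'k::field mpol \<Rightarrow> 'k poly fract" where
  "pullback e = mpol_eval const_kt (\<lambda>i. t_pow (e i))"


section \<open>Subsheaves of the constant sheaf\<close>

text \<open>
  A subsheaf of the constant sheaf \<open>k(t)\<close> is given by its stalks; its sections over an open set \<open>U\<close> are
  the elements of \<open>k(t)\<close> that belong to the stalks at all points of \<open>U\<close>.
\<close>

type_synonym 'k rsheaf = "'k ppoint \<Rightarrow> 'k poly fract set"

definition structure_sheaf :: "nat \<Rightarrow> (nat \<Rightarrow> nat) \<Rightarrow> 'k::field rsheaf" where
  "structure_sheaf m e R =
     {pullback e F / pullback e G | F G d. homogeneous m d F \<and> homogeneous m d G \<and> nonzero_at G R}"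

definition generated_sheaf ::
    "nat \<Rightarrow> (nat \<Rightarrow> nat) \<Rightarrow> 'k::field poly fract list \<Rightarrow> 'k rsheaf" where
  "generated_sheaf m e fs R =
     {\<Sum>i<length fs. fs ! i * u i | u. \<forall>i<length fs. u i \<in> structure_sheaf m e R}"

definition sections :: "'k::field rsheaf \<Rightarrow> 'k ppoint set \<Rightarrow> 'k poly fract set" where
  "sections \<F> U = (\<Inter>R\<in>U. \<F> R)"

text \<open>
  An isomorphism from \<open>\<O>\<close> onto \<open>\<F>\<close> over a nonempty open set, both being nonzero subsheaves of the
  constant sheaf, is the multiplication by a nonzero rational function.
\<close>

definition invertible_sheaf :: "nat \<Rightarrow> (nat \<Rightarrow> nat) \<Rightarrow> 'k::field rsheaf \<Rightarrow> bool" where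
  "invertible_sheaf m e \<F> \<longleftrightarrow>
     (\<forall>R\<in>monomial_curve m e. \<exists>U f. zariski_open m e U \<and> R \<in> U \<and> f \<noteq> 0 \<and>
        (\<forall>Q\<in>U. \<F> Q = (\<lambda>u. f * u) ` structure_sheaf m e Q))"


section \<open>Cohomology, degree and Clifford index\<close>

definition scale_kt :: "'k::field \<Rightarrow> 'k poly fract \<Rightarrow> 'k poly fract" where
  "scale_kt c f = const_kt c * f"

definition scale_fam ::
    "'k::field \<Rightarrow> ('k ppoint \<Rightarrow> 'k poly fract) \<Rightarrow> ('k ppoint \<Rightarrow> 'k poly fract)" where
  "scale_fam c s = (\<lambda>R. scale_kt c (s R))"

lemma const_kt_hom:
  "const_kt (a + b) = const_kt a + const_kt b"
  "const_kt (a * b) = const_kt a * const_kt b"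
  "const_kt 1 = 1"
  by (simp_all add: const_kt_def pCons_one flip: to_fract_add to_fract_mult)

global_interpretation kt: vector_space scale_kt
  by unfold_locales (simp_all add: scale_kt_def const_kt_hom algebra_simps)

global_interpretation fam: vector_space scale_fam
  by unfold_locales
    (simp_all add: scale_fam_def fun_eq_iff kt.scale_right_distrib kt.scale_left_distrib)

definition h0 :: "nat \<Rightarrow> (nat \<Rightarrow> nat) \<Rightarrow> 'k::field rsheaf \<Rightarrow> nat" where
  "h0 m e \<F> = kt.dim (sections \<F> (monomial_curve m e))"

text \<open>
  The constant sheaf \<open>K = k(t)\<close> is flasque, hence \<open>0 \<rightarrow> \<F> \<rightarrow> K \<rightarrow> K/\<F> \<rightarrow> 0\<close> shows that the first
  cohomology of \<open>\<F>\<close> is the cokernel of the map from \<open>K\<close> to the global sections of \<open>K/\<F>\<close>.  Such a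
  section is represented by a family of elements of \<open>K\<close>, one at each point, which modulo the stalks of
  \<open>\<F>\<close> is locally given by one rational function.  The family represents the image of an element of \<open>K\<close>
  iff one rational function does it for all points.
\<close>

definition quotient_section_families ::
    "nat \<Rightarrow> (nat \<Rightarrow> nat) \<Rightarrow> 'k::field rsheaf \<Rightarrow> ('k ppoint \<Rightarrow> 'k poly fract) set" where
  "quotient_section_families m e \<F> =
     {s. \<forall>R\<in>monomial_curve m e. \<exists>U f. zariski_open m e U \<and> R \<in> U \<and> (\<forall>Q\<in>U. s Q - f \<in> \<F> Q)}"

definition global_families ::
    "nat \<Rightarrow> (nat \<Rightarrow> nat) \<Rightarrow> 'k::field rsheaf \<Rightarrow> ('k ppoint \<Rightarrow> 'k poly fract) set" where
  "global_families m e \<F> = {s. \<exists>f. \<forall>Q\<in>monomial_curve m e. s Q - f \<in> \<F> Q}"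

text \<open>
  The dimension of \<open>A/B\<close> for subspaces \<open>B \<subseteq> A\<close>: the cardinality of a basis of a complement of \<open>B\<close> in
  \<open>A\<close>, being \<open>0\<close> if \<open>A/B\<close> is infinite dimensional (as for \<open>dim\<close> in the library).
\<close>

definition quotient_dim ::
    "('k::field ppoint \<Rightarrow> 'k poly fract) set \<Rightarrow> ('k ppoint \<Rightarrow> 'k poly fract) set \<Rightarrow> nat" where
  "quotient_dim A B =
     card (SOME X. fam.independent X \<and> fam.span X \<inter> B = {0} \<and> fam.span (X \<union> B) = A)"

definition h1 :: "nat \<Rightarrow> (nat \<Rightarrow> nat) \<Rightarrow> 'k::field rsheaf \<Rightarrow> nat" where
  "h1 m e \<F> = quotient_dim (quotient_section_families m e \<F>) (global_families m e \<F>)"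

definition euler_char :: "nat \<Rightarrow> (nat \<Rightarrow> nat) \<Rightarrow> 'k::field rsheaf \<Rightarrow> int" where
  "euler_char m e \<F> = int (h0 m e \<F>) - int (h1 m e \<F>)"

definition sheaf_degree :: "nat \<Rightarrow> (nat \<Rightarrow> nat) \<Rightarrow> 'k::field rsheaf \<Rightarrow> int" where
  "sheaf_degree m e \<F> = euler_char m e \<F> - euler_char m e (structure_sheaf m e :: 'k rsheaf)"

definition clifford_index :: "nat \<Rightarrow> (nat \<Rightarrow> nat) \<Rightarrow> 'k::field rsheaf \<Rightarrow> int" where
  "clifford_index m e \<F> = sheaf_degree m e \<F> - 2 * (int (h0 m e \<F>) - 1)"

definition arithmetic_genus :: "'k::field itself \<Rightarrow> nat \<Rightarrow> (nat \<Rightarrow> nat) \<Rightarrow> int" where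
  "arithmetic_genus _ m e = 1 - euler_char m e (structure_sheaf m e :: 'k rsheaf)"


section \<open>Unicuspidal curves\<close>

definition nonunits :: "'a::comm_ring_1 set \<Rightarrow> 'a set" where
  "nonunits A = {f \<in> A. \<not> (\<exists>g\<in>A. f * g = 1)}"

text \<open>
  The local rings at the closed points of a curve have dimension \<open>1\<close>, so they are regular iff their
  maximal ideal is principal.
\<close>

definition singular_point :: "nat \<Rightarrow> (nat \<Rightarrow> nat) \<Rightarrow> 'k::field ppoint \<Rightarrow> bool" where
  "singular_point m e R \<longleftrightarrow>
     (let A = structure_sheaf m e R in \<not> (\<exists>f. nonunits A = (\<lambda>u. f * u) ` A))"

definition integral_closure_kt :: "'k::field poly fract set \<Rightarrow> 'k poly fract set" where
  "integral_closure_kt A =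
     {f. \<exists>p :: 'k poly fract poly. lead_coeff p = 1 \<and> (\<forall>i. coeff p i \<in> A) \<and> poly p f = 0}"

text \<open>A point is unibranch iff the integral closure of its local ring is again a local ring.\<close>

definition unibranch_point :: "nat \<Rightarrow> (nat \<Rightarrow> nat) \<Rightarrow> 'k::field ppoint \<Rightarrow> bool" where
  "unibranch_point m e R \<longleftrightarrow>
     (let N = nonunits (integral_closure_kt (structure_sheaf m e R)) in \<forall>f\<in>N. \<forall>g\<in>N. f + g \<in> N)"

text \<open>
  The last condition is the convention that the point at infinity \<open>(0:\<dots>:0:1)\<close> is regular; it also
  ensures that the function field of the curve is the whole of \<open>k(t)\<close>.
\<close>

definition unicuspidal_monomial_curve :: "'k::field itself \<Rightarrow> nat \<Rightarrow> (nat \<Rightarrow> nat) \<Rightarrow> bool" where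
  "unicuspidal_monomial_curve _ m e \<longleftrightarrow>
     e 0 = 0 \<and> strict_mono_on {..m} e \<and>
     (\<exists>!R :: 'k ppoint. R \<in> monomial_curve m e \<and> singular_point m e R) \<and>
     singular_point m e (cusp_point m :: 'k ppoint) \<and>
     unibranch_point m e (cusp_point m :: 'k ppoint) \<and>
     e m = e (m - 1) + 1"


section \<open>The semigroup of the singular point\<close>

definition val0 :: "'k::field poly fract \<Rightarrow> int" where
  "val0 f = (THE z. \<exists>p q. p \<noteq> 0 \<and> q \<noteq> 0 \<and> f = Fract p q \<and> z = int (order 0 p) - int (order 0 q))"

definition cusp_semigroup :: "'k::field itself \<Rightarrow> nat \<Rightarrow> (nat \<Rightarrow> nat) \<Rightarrow> nat set" where
  "cusp_semigroup _ m e =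
     {j. \<exists>f \<in> structure_sheaf m e (cusp_point m :: 'k ppoint). f \<noteq> 0 \<and> val0 f = int j}"

definition gaps :: "nat set \<Rightarrow> nat set" where
  "gaps S = UNIV - S"

definition frobenius_number :: "nat set \<Rightarrow> nat" where
  "frobenius_number S = Max (gaps S)"

end

(* The stalks of O and F are given by local conditions on rational functions: regularity away from 0 and infinity; a power series expansion at 0 supported in S,
   respectively in D, the union of S and E; at infinity a pole of order at most 0, respectively a_n.
   Hence global sections of F are the polynomials of degree at most a_n supported in D, and by
   subtracting principal parts every class in H^1(F) is represented by a combination of the monomials
   t^j, placed at the cusp, with j > a_n a gap of D.  So h^0(F) = #(D \<inter> [0, a_n]) and
   h^1(F) = #([a_n + 1, \<infinity>) - D), and the formula is a count of gaps.  If F is invertible, its stalk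
   at the cusp is a unit times that of O, because it contains 1; so E is contained in S. *)

theory Submission
  imports Defs
begin

section \<open>Local conditions on rational functions\<close>

text \<open>The stalks are defined by quotients of forms of equal degree, so the main obstacle is to
  show that such quotients realize every function allowed by the local conditions. The device is to
  multiply numerator and denominator by a common factor that is harmless at the point and moves all
  exponents into weights of monomials: a power of t away from 0 and at infinity, a truncated inverse
  of the denominator at the cusp. What makes enough weights available is
  \<open>e m = e (m - 1) + 1\<close>: two consecutive generators give a semigroup with finitely many
  gaps, and among the weights of degree d the largest d + 1 candidates all occur. For the first
  cohomology, a section of K/F is given near infinity by one rational function, which can fail at
  finitely many points only, so finitely many principal parts suffice. Algebraic closedness enters
  where a function without poles on the affine line must be a polynomial. Since
  \<open>quotient_dim\<close> chooses a complement, its value is known only after all complements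
  are shown to have the same size.\<close>

definition regular_at :: "'k::field \<Rightarrow> 'k poly fract \<Rightarrow> bool" where
  "regular_at t f \<longleftrightarrow> (\<exists>p q. poly q t \<noteq> 0 \<and> f = to_fract p / to_fract q)"

definition pole_inf_le :: "nat \<Rightarrow> 'k::field poly fract \<Rightarrow> bool" where
  "pole_inf_le N f \<longleftrightarrow> (\<exists>p q. q \<noteq> 0 \<and> degree p \<le> degree q + N \<and> f = to_fract p / to_fract q)"

text \<open>A relation rather than a function, because a rational function with a pole at 0 has no
  expansion in nonnegative powers. The equation is cleared of denominators, so no series has to be
  divided.\<close>

definition has_expansion :: "'k::field poly fract \<Rightarrow> 'k fps \<Rightarrow> bool" where
  "has_expansion f h \<longleftrightarrow>
     (\<exists>p q. poly q 0 \<noteq> 0 \<and> f = to_fract p / to_fract q \<and> fps_of_poly p = h * fps_of_poly q)"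

lemma to_fract_divide_eq_iff:
  fixes p q :: "'a::idom"
  assumes "q \<noteq> 0" "q' \<noteq> 0"
  shows "to_fract p / to_fract q = to_fract p' / to_fract q' \<longleftrightarrow> p * q' = p' * q"
proof -
  have "to_fract p / to_fract q = to_fract p' / to_fract q' \<longleftrightarrow>
      to_fract (p * q') = to_fract (p' * q)"
    using assms by (simp add: frac_eq_eq)
  then show ?thesis
    by (simp only: to_fract_eq_iff)
qed

lemma fract_as_quotient:
  fixes f :: "'a::idom fract"
  obtains p q where "q \<noteq> 0" "f = to_fract p / to_fract q"
proof (cases f)
  case (Fract a b)
  then show ?thesis
    using that[of b a] by (simp add: Fract_conv_to_fract)
qed

lemma to_fract_divide_add:
  fixes p q :: "'a::idom"
  assumes "q \<noteq> 0" "q' \<noteq> 0"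
  shows "to_fract p / to_fract q + to_fract p' / to_fract q' =
    to_fract (p * q' + p' * q) / to_fract (q * q')"
  using assms by (simp add: add_frac_eq)

lemma scale_kt_divide:
  "scale_kt c (to_fract p / to_fract q) = to_fract (smult c p) / to_fract q"
proof -
  have "smult c p = [:c:] * p"
    by simp
  then show ?thesis
    unfolding scale_kt_def const_kt_def by (metis times_divide_eq_right to_fract_mult)
qed

lemma to_fract_as_quotient: "to_fract p = to_fract p / to_fract 1"
  by simp

lemma regular_at_to_fract: "regular_at t (to_fract p)"
  unfolding regular_at_def by (rule exI[of _ p], rule exI[of _ 1]) simp

lemma regular_at_subspace: "kt.subspace {f. regular_at t f}"
proof (rule kt.subspaceI; unfold mem_Collect_eq)
  show "regular_at t 0"
    using regular_at_to_fract[of t 0] by simp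
next
  fix f g assume "regular_at t f" "regular_at t g"
  then obtain p q p' q' where *: "poly q t \<noteq> 0" "f = to_fract p / to_fract q"
      "poly q' t \<noteq> 0" "g = to_fract p' / to_fract q'"
    unfolding regular_at_def by blast
  then have "q \<noteq> 0" "q' \<noteq> 0"
    by auto
  then have "f + g = to_fract (p * q' + p' * q) / to_fract (q * q')"
    using * to_fract_divide_add[of q q' p p'] by simp
  moreover have "poly (q * q') t \<noteq> 0"
    using * by simp
  ultimately show "regular_at t (f + g)"
    unfolding regular_at_def by blast
next
  fix c f assume "regular_at t f"
  then show "regular_at t (scale_kt c f)"
    unfolding regular_at_def by (metis scale_kt_divide)
qed

lemma regular_at_mult:
  assumes "regular_at t f" "regular_at t g"
  shows "regular_at t (f * g)"
proof -
  from assms obtain p q p' q' where *: "poly q t \<noteq> 0" "f = to_fract p / to_fract q"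
      "poly q' t \<noteq> 0" "g = to_fract p' / to_fract q'"
    unfolding regular_at_def by blast
  then have "f * g = to_fract (p * p') / to_fract (q * q')" "poly (q * q') t \<noteq> 0"
    by simp_all
  then show ?thesis
    unfolding regular_at_def by blast
qed

lemma pole_inf_le_to_fract: "degree p \<le> N \<Longrightarrow> pole_inf_le N (to_fract p)"
  unfolding pole_inf_le_def by (rule exI[of _ p], rule exI[of _ 1]) simp

lemma pole_inf_le_to_fractD:
  assumes "pole_inf_le N (to_fract p)"
  shows "degree p \<le> N"
proof -
  obtain p' q where *: "q \<noteq> 0" "degree p' \<le> degree q + N" "to_fract p = to_fract p' / to_fract q"
    using assms unfolding pole_inf_le_def by blast
  then have "p * q = p'"
    using to_fract_divide_eq_iff[of 1 q p p'] by simp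
  then show ?thesis
    using * by (cases "p = 0") (auto simp: degree_mult_eq)
qed

lemma pole_inf_le_mono: "pole_inf_le N f \<Longrightarrow> N \<le> M \<Longrightarrow> pole_inf_le M f"
  unfolding pole_inf_le_def by (metis add_left_mono le_trans)

lemma pole_inf_le_subspace: "kt.subspace {f :: 'k::field poly fract. pole_inf_le N f}"
proof (rule kt.subspaceI; unfold mem_Collect_eq)
  show "pole_inf_le N 0"
    using pole_inf_le_to_fract[of 0 N] by simp
next
  fix f g :: "'k poly fract" assume "pole_inf_le N f" "pole_inf_le N g"
  then obtain p q p' q' where *: "q \<noteq> 0" "degree p \<le> degree q + N" "f = to_fract p / to_fract q"
      "q' \<noteq> 0" "degree p' \<le> degree q' + N" "g = to_fract p' / to_fract q'"
    unfolding pole_inf_le_def by blast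
  then have "f + g = to_fract (p * q' + p' * q) / to_fract (q * q')"
    using to_fract_divide_add[of q q' p p'] by simp
  moreover have "q * q' \<noteq> 0"
    using * by simp
  moreover have "degree (p * q' + p' * q) \<le> degree (q * q') + N"
  proof (rule degree_add_le)
    show "degree (p * q') \<le> degree (q * q') + N"
      using * degree_mult_le[of p q'] by (simp add: degree_mult_eq)
    show "degree (p' * q) \<le> degree (q * q') + N"
      using * degree_mult_le[of p' q] by (simp add: degree_mult_eq)
  qed
  ultimately show "pole_inf_le N (f + g)"
    unfolding pole_inf_le_def by blast
next
  fix c and f :: "'k poly fract" assume "pole_inf_le N f"
  then show "pole_inf_le N (scale_kt c f)"
    unfolding pole_inf_le_def by (metis degree_smult_le le_trans scale_kt_divide)
qed

lemma pole_inf_le_mult: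
  fixes f g :: "'k::field poly fract"
  assumes "pole_inf_le N f" "pole_inf_le M g"
  shows "pole_inf_le (N + M) (f * g)"
proof -
  from assms obtain p q p' q' where *: "q \<noteq> 0" "degree p \<le> degree q + N" "f = to_fract p / to_fract q"
      "q' \<noteq> 0" "degree p' \<le> degree q' + M" "g = to_fract p' / to_fract q'"
    unfolding pole_inf_le_def by blast
  then have "f * g = to_fract (p * p') / to_fract (q * q')" "q * q' \<noteq> 0"
    by simp_all
  moreover have "degree (p * p') \<le> degree (q * q') + (N + M)"
    using * degree_mult_le[of p p'] by (simp add: degree_mult_eq)
  ultimately show ?thesis
    unfolding pole_inf_le_def by blast
qed

text \<open>For the stalk at infinity: the single generator t^N already yields all functions with a
  pole of order at most N there.\<close>

lemma pole_inf_le_divide_t_pow: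
  assumes "pole_inf_le N f"
  shows "pole_inf_le 0 (f / t_pow N)"
proof -
  obtain p q where *: "q \<noteq> 0" "degree p \<le> degree q + N" "f = to_fract p / to_fract q"
    using assms unfolding pole_inf_le_def by blast
  then have "f / t_pow N = to_fract p / to_fract (q * monom 1 N)"
    by (simp add: t_pow_def)
  moreover have "q * monom 1 N \<noteq> 0" "degree p \<le> degree (q * monom 1 N) + 0"
    using * by (auto simp: degree_mult_eq degree_monom_eq monom_eq_0_iff)
  ultimately show ?thesis
    unfolding pole_inf_le_def by blast
qed

lemma t_pow_0: "t_pow 0 = 1"
  by (simp add: t_pow_def)

lemma t_pow_nonzero: "t_pow j \<noteq> 0"
  by (simp add: t_pow_def monom_eq_0_iff)

lemma t_pow_mult: "t_pow i * t_pow j = t_pow (i + j)"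
  by (simp add: t_pow_def mult_monom flip: to_fract_mult)

lemma regular_at_t_pow: "regular_at t (t_pow j)"
  unfolding t_pow_def by (rule regular_at_to_fract)

lemma pole_inf_le_t_pow: "j \<le> N \<Longrightarrow> pole_inf_le N (t_pow j)"
  unfolding t_pow_def by (rule pole_inf_le_to_fract) (simp add: degree_monom_eq)

section \<open>Expansions at 0 and their supports\<close>

lemma has_expansion_to_fract: "has_expansion (to_fract p) (fps_of_poly p)"
  unfolding has_expansion_def by (rule exI[of _ p], rule exI[of _ 1]) simp

lemma has_expansion_t_pow: "has_expansion (t_pow j) (fps_X ^ j)"
  unfolding t_pow_def fps_of_poly_monom'[symmetric] by (rule has_expansion_to_fract)

lemma has_expansion_1: "has_expansion 1 1"
  using has_expansion_t_pow[of 0] by (simp add: t_pow_0)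

lemma has_expansion_imp_regular: "has_expansion f h \<Longrightarrow> regular_at 0 f"
  unfolding has_expansion_def regular_at_def by blast

lemma poly_0_nonzero: "poly q 0 \<noteq> 0 \<Longrightarrow> q \<noteq> (0::'a::idom poly)"
  by auto

lemma regular_imp_has_expansion:
  assumes "regular_at 0 f"
  obtains h where "has_expansion f h"
proof -
  obtain p q where *: "poly q 0 \<noteq> 0" "f = to_fract p / to_fract q"
    using assms unfolding regular_at_def by blast
  then have "fps_of_poly p = fps_of_poly p * inverse (fps_of_poly q) * fps_of_poly q"
    by (simp add: poly_0_coeff_0 inverse_mult_eq_1 mult.assoc)
  with * show ?thesis
    unfolding has_expansion_def by (intro that) (unfold has_expansion_def, blast)
qed

lemma has_expansion_unique:
  assumes "has_expansion f h" "has_expansion f h'"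
  shows "h = h'"
proof -
  obtain p q p' q' where *: "poly q 0 \<noteq> 0" "f = to_fract p / to_fract q"
      "fps_of_poly p = h * fps_of_poly q"
      "poly q' 0 \<noteq> 0" "f = to_fract p' / to_fract q'" "fps_of_poly p' = h' * fps_of_poly q'"
    using assms unfolding has_expansion_def by blast
  then have nz: "q \<noteq> 0" "q' \<noteq> 0"
    by auto
  then have "p * q' = p' * q"
    using * to_fract_divide_eq_iff[of q q' p p'] by simp
  then have "fps_of_poly p * fps_of_poly q' = fps_of_poly p' * fps_of_poly q"
    by (simp flip: fps_of_poly_mult)
  then have "h * (fps_of_poly q * fps_of_poly q') = h' * (fps_of_poly q * fps_of_poly q')"
    using * by (simp add: algebra_simps)
  moreover have "fps_of_poly q * fps_of_poly q' \<noteq> 0"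
    using nz by (metis fps_of_poly_0 fps_of_poly_eq_iff mult_eq_0_iff)
  ultimately show ?thesis
    by simp
qed

lemma has_expansion_add:
  assumes "has_expansion f h" "has_expansion g h'"
  shows "has_expansion (f + g) (h + h')"
proof -
  obtain p q p' q' where *: "poly q 0 \<noteq> 0" "f = to_fract p / to_fract q"
      "fps_of_poly p = h * fps_of_poly q"
      "poly q' 0 \<noteq> 0" "g = to_fract p' / to_fract q'" "fps_of_poly p' = h' * fps_of_poly q'"
    using assms unfolding has_expansion_def by blast
  then have "q \<noteq> 0" "q' \<noteq> 0"
    by auto
  then have "f + g = to_fract (p * q' + p' * q) / to_fract (q * q')"
    using * to_fract_divide_add[of q q' p p'] by simp
  moreover have "poly (q * q') 0 \<noteq> 0"
    using * by simp
  moreover have "fps_of_poly (p * q' + p' * q) = (h + h') * fps_of_poly (q * q')"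
    using * by (simp add: fps_of_poly_add fps_of_poly_mult algebra_simps)
  ultimately show ?thesis
    unfolding has_expansion_def by blast
qed

lemma has_expansion_mult:
  assumes "has_expansion f h" "has_expansion g h'"
  shows "has_expansion (f * g) (h * h')"
proof -
  obtain p q p' q' where *: "poly q 0 \<noteq> 0" "f = to_fract p / to_fract q"
      "fps_of_poly p = h * fps_of_poly q"
      "poly q' 0 \<noteq> 0" "g = to_fract p' / to_fract q'" "fps_of_poly p' = h' * fps_of_poly q'"
    using assms unfolding has_expansion_def by blast
  then have "f * g = to_fract (p * p') / to_fract (q * q')" "poly (q * q') 0 \<noteq> 0"
      "fps_of_poly (p * p') = (h * h') * fps_of_poly (q * q')"
    by (simp_all add: fps_of_poly_mult algebra_simps)
  then show ?thesis
    unfolding has_expansion_def by blast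
qed

lemma has_expansion_scale: "has_expansion f h \<Longrightarrow> has_expansion (scale_kt c f) (fps_const c * h)"
  unfolding scale_kt_def const_kt_def
  by (rule has_expansion_mult) (simp_all add: has_expansion_to_fract flip: fps_of_poly_const)

lemma has_expansion_diff:
  assumes "has_expansion f h" "has_expansion g h'"
  shows "has_expansion (f - g) (h - h')"
proof -
  have "has_expansion (scale_kt (-1) g) (- h')"
    using has_expansion_scale[OF assms(2), of "-1"] by (simp flip: fps_const_neg)
  then show ?thesis
    using has_expansion_add[OF assms(1)] by fastforce
qed

text \<open>Membership includes regularity at 0. For D the semigroup this will be the local ring at
  the cusp; for D = \<open>{N..}\<close> it consists of the functions vanishing at 0 to order at
  least N.\<close>

definition supp_fun :: "nat set \<Rightarrow> 'k::field poly fract set" where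
  "supp_fun D = {f. \<exists>h. has_expansion f h \<and> (\<forall>j. j \<notin> D \<longrightarrow> fps_nth h j = 0)}"

lemma supp_fun_subspace: "kt.subspace (supp_fun D)"
proof (rule kt.subspaceI)
  show "0 \<in> supp_fun D"
    using has_expansion_to_fract[of 0] unfolding supp_fun_def by force
next
  fix f g :: "'a poly fract" assume "f \<in> supp_fun D" "g \<in> supp_fun D"
  then obtain h h' where *: "has_expansion f h" "\<forall>j. j \<notin> D \<longrightarrow> fps_nth h j = 0"
      "has_expansion g h'" "\<forall>j. j \<notin> D \<longrightarrow> fps_nth h' j = 0"
    unfolding supp_fun_def by blast
  then have "has_expansion (f + g) (h + h')" "\<forall>j. j \<notin> D \<longrightarrow> fps_nth (h + h') j = 0"
    by (simp_all add: has_expansion_add)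
  then show "f + g \<in> supp_fun D"
    unfolding supp_fun_def by blast
next
  fix c and f :: "'a poly fract" assume "f \<in> supp_fun D"
  then obtain h where *: "has_expansion f h" "\<forall>j. j \<notin> D \<longrightarrow> fps_nth h j = 0"
    unfolding supp_fun_def by blast
  then have "has_expansion (scale_kt c f) (fps_const c * h)"
      "\<forall>j. j \<notin> D \<longrightarrow> fps_nth (fps_const c * h) j = 0"
    by (simp_all add: has_expansion_scale)
  then show "scale_kt c f \<in> supp_fun D"
    unfolding supp_fun_def by blast
qed

lemma t_pow_in_supp_fun: "j \<in> D \<Longrightarrow> t_pow j \<in> supp_fun D"
  unfolding supp_fun_def using has_expansion_t_pow[of j] by (auto simp: fps_X_power_nth intro!: exI)

lemma supp_fun_regular: "f \<in> supp_fun D \<Longrightarrow> regular_at 0 f"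
  unfolding supp_fun_def using has_expansion_imp_regular by blast

lemma supp_fun_mono: "D \<subseteq> D' \<Longrightarrow> supp_fun D \<subseteq> supp_fun D'"
  unfolding supp_fun_def by blast

lemma supp_fun_to_fract_iff:
  "to_fract p \<in> supp_fun D \<longleftrightarrow> (\<forall>j. j \<notin> D \<longrightarrow> coeff p j = 0)"
proof
  assume "to_fract p \<in> supp_fun D"
  then obtain h where "has_expansion (to_fract p) h" "\<forall>j. j \<notin> D \<longrightarrow> fps_nth h j = 0"
    unfolding supp_fun_def by blast
  moreover from this have "h = fps_of_poly p"
    using has_expansion_unique has_expansion_to_fract by blast
  ultimately show "\<forall>j. j \<notin> D \<longrightarrow> coeff p j = 0"
    by simp
next
  assume "\<forall>j. j \<notin> D \<longrightarrow> coeff p j = 0"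
  then show "to_fract p \<in> supp_fun D"
    unfolding supp_fun_def using has_expansion_to_fract[of p] by fastforce
qed

lemma supp_fun_mult:
  assumes "f \<in> supp_fun D" "g \<in> supp_fun D'" "\<And>i j. i \<in> D \<Longrightarrow> j \<in> D' \<Longrightarrow> i + j \<in> D''"
  shows "f * g \<in> supp_fun D''"
proof -
  obtain h h' where *: "has_expansion f h" "\<forall>j. j \<notin> D \<longrightarrow> fps_nth h j = 0"
      "has_expansion g h'" "\<forall>j. j \<notin> D' \<longrightarrow> fps_nth h' j = 0"
    using assms(1,2) unfolding supp_fun_def by blast
  have "fps_nth (h * h') j = 0" if "j \<notin> D''" for j
    unfolding fps_mult_nth
  proof (rule sum.neutral, clarify)
    fix i assume i: "i \<in> {0..j}"
    have "i \<notin> D \<or> j - i \<notin> D'"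
      using assms(3)[of i "j - i"] i that by auto
    then show "fps_nth h i * fps_nth h' (j - i) = 0"
      using * by auto
  qed
  then show ?thesis
    using has_expansion_mult[OF *(1,3)] unfolding supp_fun_def by blast
qed

text \<open>The \<open>c j\<close> are the Taylor coefficients of f. With N beyond the gaps the
  remainder is harmless, so infinite expansions reduce to finitely many monomials.\<close>

lemma supp_fun_finite_part:
  assumes "f \<in> supp_fun D"
  obtains c where "f - (\<Sum>j<N. scale_kt (c j) (t_pow j)) \<in> supp_fun {N..}"
    and "\<And>j. j \<notin> D \<Longrightarrow> c j = 0"
proof -
  obtain h where h: "has_expansion f h" "\<forall>j. j \<notin> D \<longrightarrow> fps_nth h j = 0"
    using assms unfolding supp_fun_def by blast
  have "has_expansion (\<Sum>j<n. scale_kt (fps_nth h j) (t_pow j)) (fps_cutoff n h)" for n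
  proof (induction n)
    case 0
    then show ?case
      using has_expansion_to_fract[of 0] by simp
  next
    case (Suc n)
    have "fps_cutoff (Suc n) h = fps_cutoff n h + fps_const (fps_nth h n) * fps_X ^ n"
      by (rule fps_ext) (auto simp: fps_X_power_nth less_Suc_eq)
    then show ?case
      using has_expansion_add[OF Suc has_expansion_scale[OF has_expansion_t_pow[of n]]] by simp
  qed
  then have "has_expansion (f - (\<Sum>j<N. scale_kt (fps_nth h j) (t_pow j))) (h - fps_cutoff N h)"
    using h(1) has_expansion_diff by blast
  then have "f - (\<Sum>j<N. scale_kt (fps_nth h j) (t_pow j)) \<in> supp_fun {N..}"
    unfolding supp_fun_def by (auto intro!: exI[of _ "h - fps_cutoff N h"])
  then show ?thesis
    using that h by blast
qed

section \<open>Principal parts and global regularity\<close>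

text \<open>Partial fractions at one point, by induction on the bound r for the pole order. The part
  f is a sum of terms c / (T - t)^i, hence regular elsewhere and without a pole at infinity.\<close>

lemma principal_part_step:
  fixes t :: "'k::field"
  assumes "poly q t \<noteq> 0"
  shows "\<exists>f. regular_at t (to_fract p / to_fract ([:-t, 1:] ^ r * q) - f) \<and>
    (\<forall>s. s \<noteq> t \<longrightarrow> regular_at s f) \<and> pole_inf_le 0 f"
proof (induction r arbitrary: p)
  case 0
  have "regular_at t (to_fract p / to_fract ([:-t, 1:] ^ 0 * q) - 0)"
    using assms unfolding regular_at_def by auto
  moreover have "regular_at s (0 :: 'k poly fract)" for s
    using regular_at_to_fract[of s 0] by simp
  moreover have "pole_inf_le 0 (0 :: 'k poly fract)"
    using pole_inf_le_to_fract[of 0 0] by simp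
  ultimately show ?case
    by blast
next
  case (Suc r)
  define L where "L = [:-t, 1:]"
  \<comment> \<open>Subtracting \<open>c / (T - t) ^ Suc r\<close> lowers the pole order at \<open>t\<close>.\<close>
  define c where "c = poly p t / poly q t"
  have "poly (p - smult c q) t = 0"
    using assms by (simp add: c_def)
  then obtain p' where p': "p - smult c q = L * p'"
    unfolding L_def poly_eq_0_iff_dvd by (elim dvdE)
  obtain f where f: "regular_at t (to_fract p' / to_fract (L ^ r * q) - f)"
      "\<forall>s. s \<noteq> t \<longrightarrow> regular_at s f" "pole_inf_le 0 f"
    using Suc[of p'] unfolding L_def by blast
  define g where "g = to_fract [:c:] / to_fract (L ^ Suc r)"
  have L0: "L \<noteq> 0"
    by (simp add: L_def)
  have q0: "q \<noteq> 0"
    using assms by auto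
  have "to_fract p / to_fract (L ^ Suc r * q) = g + to_fract p' / to_fract (L ^ r * q)"
  proof -
    have "g + to_fract p' / to_fract (L ^ r * q) =
        to_fract ([:c:] * (L ^ r * q) + p' * L ^ Suc r) / to_fract (L ^ Suc r * (L ^ r * q))"
      unfolding g_def using L0 q0 by (intro to_fract_divide_add) simp_all
    also have "\<dots> = to_fract p / to_fract (L ^ Suc r * q)"
    proof (subst to_fract_divide_eq_iff)
      have "p = smult c q + L * p'"
        using p' by (simp add: algebra_simps)
      then show "([:c:] * (L ^ r * q) + p' * L ^ Suc r) * (L ^ Suc r * q) =
          p * (L ^ Suc r * (L ^ r * q))"
        by (simp add: algebra_simps)
    qed (use L0 q0 in simp_all)
    finally show ?thesis
      by simp
  qed
  then have "regular_at t (to_fract p / to_fract (L ^ Suc r * q) - (g + f))"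
    using f(1) by (simp add: algebra_simps)
  moreover have "regular_at s (g + f)" if "s \<noteq> t" for s
  proof -
    have "poly (L ^ Suc r) s \<noteq> 0"
      using that by (simp add: L_def)
    then have "regular_at s g"
      unfolding g_def regular_at_def by blast
    then show ?thesis
      using f(2) that kt.subspace_add[OF regular_at_subspace] by fastforce
  qed
  moreover have "pole_inf_le 0 (g + f)"
  proof -
    have "pole_inf_le 0 g"
      unfolding g_def pole_inf_le_def using L0
      by (intro exI[of _ "[:c:]"] exI[of _ "L ^ Suc r"]) simp
    then show ?thesis
      using f(3) kt.subspace_add[OF pole_inf_le_subspace[of 0]] by fastforce
  qed
  ultimately show ?case
    unfolding L_def by blast
qed

lemma principal_part:
  fixes \<phi> :: "'k::field poly fract"
  shows "\<exists>f. regular_at t (\<phi> - f) \<and> (\<forall>s. s \<noteq> t \<longrightarrow> regular_at s f) \<and> pole_inf_le 0 f"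
proof -
  obtain p q where *: "q \<noteq> 0" "\<phi> = to_fract p / to_fract q"
    by (rule fract_as_quotient)
  obtain q' where q': "q = [:-t, 1:] ^ order t q * q'" "\<not> [:-t, 1:] dvd q'"
    using order_decomp[OF *(1)] by blast
  then have "poly q' t \<noteq> 0"
    by (simp add: poly_eq_0_iff_dvd)
  from principal_part_step[OF this, of p "order t q"] show ?thesis
    using q'(1) *(2) by simp
qed

text \<open>Principal parts at different points can be prescribed independently: each one is regular
  off its own point, so adding it does not disturb the others. The bound at infinity ensures that
  the condition there survives the correction.\<close>

lemma principal_parts:
  fixes \<phi> :: "'k::field \<Rightarrow> 'k poly fract"
  assumes "finite Z"
  shows "\<exists>f. (\<forall>t\<in>Z. regular_at t (\<phi> t - f)) \<and> (\<forall>s. s \<notin> Z \<longrightarrow> regular_at s f) \<and> pole_inf_le 0 f"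
  using assms
proof (induction Z)
  case empty
  have "regular_at s (0 :: 'k poly fract)" for s
    using regular_at_to_fract[of s 0] by simp
  moreover have "pole_inf_le 0 (0 :: 'k poly fract)"
    using pole_inf_le_to_fract[of 0 0] by simp
  ultimately show ?case
    by blast
next
  case (insert z Z)
  obtain f where f: "\<forall>t\<in>Z. regular_at t (\<phi> t - f)" "\<forall>s. s \<notin> Z \<longrightarrow> regular_at s f" "pole_inf_le 0 f"
    using insert by blast
  obtain g where g: "regular_at z (\<phi> z - g)" "\<forall>s. s \<noteq> z \<longrightarrow> regular_at s g" "pole_inf_le 0 g"
    using principal_part[of z "\<phi> z"] by blast
  have diff: "regular_at t (a - b)" if "regular_at t a" "regular_at t b" for t and a b :: "'k poly fract"
    using kt.subspace_diff[OF regular_at_subspace] that by blast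
  have add: "regular_at t (a + b)" if "regular_at t a" "regular_at t b" for t and a b :: "'k poly fract"
    using kt.subspace_add[OF regular_at_subspace] that by blast
  have "regular_at t (\<phi> t - (f + g))" if t: "t \<in> insert z Z" for t
  proof (cases "t = z")
    case True
    then show ?thesis
      using diff[OF g(1), of f] f(2) insert(2) by (simp add: algebra_simps)
  next
    case False
    then show ?thesis
      using diff[of t "\<phi> t - f" g] f(1) g(2) t by (simp add: algebra_simps)
  qed
  moreover have "regular_at s (f + g)" if "s \<notin> insert z Z" for s
    using add f(2) g(2) that by simp
  moreover have "pole_inf_le 0 (f + g)"
    using kt.subspace_add[OF pole_inf_le_subspace] f(3) g(3) by blast
  ultimately show ?case
    by blast
qed

text \<open>Induction on the degree of a denominator. A nonconstant one has a root t, and regularity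
  at t forces the numerator to vanish there too, so the factor T - t cancels.\<close>

lemma regular_everywhere_imp_poly:
  fixes f :: "'k::alg_closed_field poly fract"
  assumes "\<And>t. regular_at t f"
  obtains p where "f = to_fract p"
proof -
  have "\<exists>p. f = to_fract p" if "q \<noteq> 0" "f = to_fract p / to_fract q" for p q
    using that
  proof (induction "degree q" arbitrary: p q rule: less_induct)
    case less
    show ?case
    proof (cases "degree q = 0")
      case True
      then obtain c where c: "q = [:c:]"
        by (rule degree_eq_zeroE)
      with less.prems have "c \<noteq> 0"
        by simp
      then have "f = to_fract (smult (inverse c) p) / to_fract 1"
        unfolding less.prems(2) using c by (subst to_fract_divide_eq_iff) simp_all
      then show ?thesis
        by (metis to_fract_as_quotient)
    next
      case False
      then obtain t where t: "poly q t = 0"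
        using alg_closed_imp_poly_has_root by blast
      obtain p' q' where *: "poly q' t \<noteq> 0" "f = to_fract p' / to_fract q'"
        using assms[of t] unfolding regular_at_def by blast
      then have "q' \<noteq> 0"
        by auto
      then have "p * q' = p' * q"
        using * less.prems to_fract_divide_eq_iff[of q q' p p'] by simp
      then have "poly p t * poly q' t = 0"
        using t by (metis mult_zero_right poly_mult)
      then have "poly p t = 0"
        using * by simp
      with t obtain p1 q1 where pq: "p = [:-t, 1:] * p1" "q = [:-t, 1:] * q1"
        unfolding poly_eq_0_iff_dvd by (elim dvdE)
      then have q1: "q1 \<noteq> 0"
        using less.prems by auto
      have "degree q = Suc (degree q1)"
        unfolding pq(2) using q1 by (subst degree_mult_eq) auto
      moreover have "f = to_fract p1 / to_fract q1"
        unfolding less.prems(2) using less.prems(1) q1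
        by (subst to_fract_divide_eq_iff) (simp_all only: pq ac_simps, simp_all)
      ultimately show ?thesis
        using less.hyps q1 by simp
    qed
  qed
  then show ?thesis
    using that by (metis fract_as_quotient)
qed

section \<open>Points and stalks of the structure sheaf\<close>

definition affine_pt :: "nat \<Rightarrow> (nat \<Rightarrow> nat) \<Rightarrow> 'k::field \<Rightarrow> 'k ppoint" where
  "affine_pt m e t = proj_point m (\<lambda>i. t ^ e i)"

definition inf_pt :: "nat \<Rightarrow> 'k::field ppoint" where
  "inf_pt m = proj_point m (\<lambda>i. if i = m then 1 else 0)"

text \<open>The exponent of t into which the monomial with exponents \<open>\<mu>\<close> turns
  under x_i = t^(e i).\<close>

definition wt :: "(nat \<Rightarrow> nat) \<Rightarrow> (nat \<Rightarrow>\<^sub>0 nat) \<Rightarrow> nat" where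
  "wt e \<mu> = (\<Sum>i\<in>Poly_Mapping.keys \<mu>. Poly_Mapping.lookup \<mu> i * e i)"

definition pullback_poly :: "(nat \<Rightarrow> nat) \<Rightarrow> 'k::field mpol \<Rightarrow> 'k poly" where
  "pullback_poly e F = (\<Sum>\<mu>\<in>Poly_Mapping.keys F. monom (Poly_Mapping.lookup F \<mu>) (wt e \<mu>))"

definition wts :: "nat \<Rightarrow> (nat \<Rightarrow> nat) \<Rightarrow> nat \<Rightarrow> nat set" where
  "wts m e d = {wt e \<mu> | \<mu>. Poly_Mapping.keys \<mu> \<subseteq> {..m} \<and>
     (\<Sum>i\<in>Poly_Mapping.keys \<mu>. Poly_Mapping.lookup \<mu> i) = d}"

text \<open>These turn out to be exactly the pullbacks of the forms of degree d, which lets the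
  stalks be studied with polynomials in one variable.\<close>

definition form_polys :: "nat \<Rightarrow> (nat \<Rightarrow> nat) \<Rightarrow> nat \<Rightarrow> 'k::field poly set" where
  "form_polys m e d = {p. \<forall>j. coeff p j \<noteq> 0 \<longrightarrow> j \<in> wts m e d}"

lemma proj_point_cong:
  assumes "c \<noteq> 0" "\<And>i. i \<le> m \<Longrightarrow> x i = c * y i"
  shows "proj_point m x = proj_point m y"
proof -
  have "(\<exists>d. d \<noteq> 0 \<and> (\<forall>i\<le>m. z i = d * x i)) \<longleftrightarrow> (\<exists>d. d \<noteq> 0 \<and> (\<forall>i\<le>m. z i = d * y i))" for z
  proof
    assume "\<exists>d. d \<noteq> 0 \<and> (\<forall>i\<le>m. z i = d * x i)"
    then obtain d where "d \<noteq> 0" "\<forall>i\<le>m. z i = d * x i"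
      by blast
    then show "\<exists>d. d \<noteq> 0 \<and> (\<forall>i\<le>m. z i = d * y i)"
      using assms by (intro exI[of _ "d * c"]) simp
  next
    assume "\<exists>d. d \<noteq> 0 \<and> (\<forall>i\<le>m. z i = d * y i)"
    then obtain d where "d \<noteq> 0" "\<forall>i\<le>m. z i = d * y i"
      by blast
    then show "\<exists>d. d \<noteq> 0 \<and> (\<forall>i\<le>m. z i = d * x i)"
      using assms by (intro exI[of _ "d / c"]) simp
  qed
  then show ?thesis
    unfolding proj_point_def by blast
qed

lemma proj_point_rep: "(\<lambda>i. if i \<le> m then x i else 0) \<in> proj_point m x"
  unfolding proj_point_def by (auto intro!: exI[of _ 1])

lemma t_pow_power: "t_pow i ^ n = t_pow (n * i)"
  by (induction n) (simp_all add: t_pow_0 t_pow_mult)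

lemma t_pow_prod: "(\<Prod>i\<in>A. t_pow (f i)) = t_pow (\<Sum>i\<in>A. f i)"
  by (induction A rule: infinite_finite_induct) (simp_all add: t_pow_0 t_pow_mult)

lemma const_kt_t_pow: "const_kt c * t_pow j = to_fract (monom c j)"
  by (simp add: const_kt_def t_pow_def smult_monom flip: to_fract_mult)

lemma pullback_eq: "pullback e F = to_fract (pullback_poly e F)"
  by (simp add: pullback_def mpol_eval_def pullback_poly_def t_pow_power t_pow_prod const_kt_t_pow
      flip: wt_def)

lemma mpol_eval_affine:
  assumes "homogeneous m d F" "\<And>i. i \<le> m \<Longrightarrow> x i = c * t ^ e i"
  shows "mpol_eval (\<lambda>c. c) x F = c ^ d * poly (pullback_poly e F) t"
proof -
  have "(\<Prod>i\<in>Poly_Mapping.keys \<mu>. x i ^ Poly_Mapping.lookup \<mu> i) = c ^ d * t ^ wt e \<mu>"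
    if "\<mu> \<in> Poly_Mapping.keys F" for \<mu>
  proof -
    have \<mu>: "Poly_Mapping.keys \<mu> \<subseteq> {..m}" "(\<Sum>i\<in>Poly_Mapping.keys \<mu>. Poly_Mapping.lookup \<mu> i) = d"
      using assms(1) that unfolding homogeneous_def by auto
    have "(\<Prod>i\<in>Poly_Mapping.keys \<mu>. x i ^ Poly_Mapping.lookup \<mu> i) =
        (\<Prod>i\<in>Poly_Mapping.keys \<mu>. c ^ Poly_Mapping.lookup \<mu> i * t ^ (Poly_Mapping.lookup \<mu> i * e i))"
      using \<mu>(1) assms(2)
      by (intro prod.cong) (auto simp: power_mult_distrib mult.commute simp flip: power_mult)
    also have "\<dots> = c ^ d * t ^ wt e \<mu>"
      unfolding wt_def prod.distrib \<mu>(2)[symmetric] by (simp add: power_sum)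
    finally show ?thesis .
  qed
  then have "mpol_eval (\<lambda>c. c) x F =
      (\<Sum>\<mu>\<in>Poly_Mapping.keys F. Poly_Mapping.lookup F \<mu> * (c ^ d * t ^ wt e \<mu>))"
    unfolding mpol_eval_def by simp
  then show ?thesis
    by (simp add: pullback_poly_def poly_sum poly_monom sum_distrib_left algebra_simps)
qed

lemma homogeneous_variable: "i \<le> m \<Longrightarrow>
    homogeneous m 1 (Poly_Mapping.single (Poly_Mapping.single i 1) (1 :: 'k::field))"
  by (simp add: homogeneous_def)

lemma pullback_poly_variable:
  "pullback_poly e (Poly_Mapping.single (Poly_Mapping.single i 1) (1 :: 'k::field)) = monom 1 (e i)"
  by (simp add: pullback_poly_def wt_def)

section \<open>Points of the curve and vanishing of forms\<close>

locale monomial_exponents =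
  fixes m :: nat and e :: "nat \<Rightarrow> nat"
  assumes e_0: "e 0 = 0" and e_mono: "strict_mono_on {..m} e" and e_last: "e m = e (m - 1) + 1"
begin

text \<open>For m = 0 the truncated difference m - 1 is 0, and \<open>e_last\<close> would read e 0
  = e 0 + 1.\<close>

lemma m_pos: "m > 0"
  using e_0 e_last by (cases m) auto

lemma e_less: "i < j \<Longrightarrow> j \<le> m \<Longrightarrow> e i < e j"
  using e_mono by (auto simp: strict_mono_on_def)

lemma e_le: "i \<le> m \<Longrightarrow> e i \<le> e m"
  using e_less[of i m] by (cases "i = m") auto

lemma e_pos: "0 < i \<Longrightarrow> i \<le> m \<Longrightarrow> 0 < e i"
  using e_less[of 0 i] by simp

lemma monomial_curve_eq:
  "monomial_curve m e = insert (inf_pt m) (range (affine_pt m e :: 'k::field \<Rightarrow> _))"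
proof (rule subset_antisym)
  show "monomial_curve m e \<subseteq> insert (inf_pt m) (range (affine_pt m e :: 'k \<Rightarrow> _))"
  proof
    fix R :: "'k ppoint" assume "R \<in> monomial_curve m e"
    then obtain s t where st: "R = proj_point m (\<lambda>i. s ^ (e m - e i) * t ^ e i)" "(s, t) \<noteq> (0, 0)"
      unfolding monomial_curve_def by blast
    show "R \<in> insert (inf_pt m) (range (affine_pt m e))"
    proof (cases "s = 0")
      case True
      have "R = inf_pt m"
        unfolding st(1) inf_pt_def
      proof (rule proj_point_cong)
        show "t ^ e m \<noteq> 0"
          using st(2) True by simp
        show "s ^ (e m - e i) * t ^ e i = t ^ e m * (if i = m then 1 else 0)" if "i \<le> m" for i
          using e_less[of i m] that by (cases "i = m") (auto simp: True)
      qed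
      then show ?thesis
        by simp
    next
      case False
      have "R = affine_pt m e (t / s)"
        unfolding st(1) affine_pt_def
      proof (rule proj_point_cong)
        show "s ^ e m \<noteq> 0"
          using False by simp
        show "s ^ (e m - e i) * t ^ e i = s ^ e m * (t / s) ^ e i" if "i \<le> m" for i
          using e_le[OF that] False by (simp add: power_divide power_diff)
      qed
      then show ?thesis
        by simp
    qed
  qed
  have "affine_pt m e t \<in> monomial_curve m e" for t :: 'k
    unfolding monomial_curve_def affine_pt_def
    by (rule CollectI, rule exI[of _ 1], rule exI[of _ t]) simp
  moreover have "inf_pt m \<in> (monomial_curve m e :: 'k ppoint set)"
  proof -
    \<comment> \<open>The exponent e m - e i is positive except for i = m, where
      \<open>0 ^ 0 = 1\<close>.\<close>
    have "inf_pt m = proj_point m (\<lambda>i. (0::'k) ^ (e m - e i) * 1 ^ e i)"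
      unfolding inf_pt_def
    proof (rule proj_point_cong)
      show "(if i = m then 1 else 0) = (1::'k) * (0 ^ (e m - e i) * 1 ^ e i)" if "i \<le> m" for i
        using e_less[of i m] that by (cases "i = m") auto
    qed simp
    then show ?thesis
      unfolding monomial_curve_def by (intro CollectI exI[of _ 0] exI[of _ 1]) simp
  qed
  ultimately show "insert (inf_pt m) (range (affine_pt m e :: 'k \<Rightarrow> _)) \<subseteq> monomial_curve m e"
    by blast
qed

lemma affine_ne_inf: "affine_pt m e (t :: 'k::field) \<noteq> inf_pt m"
proof
  let ?y = "\<lambda>i. if i \<le> m then t ^ e i else 0"
  assume "affine_pt m e t = inf_pt m"
  then have "?y \<in> inf_pt m"
    using proj_point_rep[of m "\<lambda>i. t ^ e i"] by (simp add: affine_pt_def)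
  then obtain c where "\<forall>i\<le>m. ?y i = c * (if i = m then 1 else 0)"
    unfolding inf_pt_def proj_point_def by blast
  then show False
    using m_pos e_0 by (auto dest: spec[of _ 0])
qed

lemma affine_pt_inj: "affine_pt m e (t :: 'k::field) = affine_pt m e s \<longleftrightarrow> t = s"
proof
  let ?y = "\<lambda>i. if i \<le> m then t ^ e i else 0"
  assume "affine_pt m e t = affine_pt m e s"
  then have "?y \<in> affine_pt m e s"
    using proj_point_rep[of m "\<lambda>i. t ^ e i"] by (simp add: affine_pt_def)
  then obtain c where c: "\<forall>i\<le>m. ?y i = c * s ^ e i"
    unfolding affine_pt_def proj_point_def by blast
  then have "c = 1"
    using e_0 by (auto dest: spec[of _ 0])
  with c have "t ^ e i = s ^ e i" if "i \<le> m" for i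
    using that by (auto dest: spec[of _ i])
  \<comment> \<open>The exponents e m and e (m - 1) differ by 1, so a nonzero t is the quotient of
    two coordinates.\<close>
  from this[of m] this[of "m - 1"] show "t = s"
    using e_last by (cases "t = 0"; cases "s = 0") auto
qed simp

lemma cusp_point_eq: "cusp_point m = (affine_pt m e 0 :: 'k::field ppoint)"
  unfolding cusp_point_def affine_pt_def
proof (rule proj_point_cong)
  show "(if i = 0 then 1 else 0) = 1 * (0::'k) ^ e i" if "i \<le> m" for i
    using e_pos[of i] that e_0 by (cases "i = 0") auto
qed simp

lemma nonzero_at_affine:
  assumes "homogeneous m d F"
  shows "nonzero_at F (affine_pt m e t) \<longleftrightarrow> poly (pullback_poly e F) t \<noteq> 0"
proof
  assume *: "nonzero_at F (affine_pt m e t)"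
  have "mpol_eval (\<lambda>c. c) (\<lambda>i. if i \<le> m then t ^ e i else 0) F \<noteq> 0"
    using * proj_point_rep[of m "\<lambda>i. t ^ e i"] unfolding nonzero_at_def affine_pt_def by blast
  then show "poly (pullback_poly e F) t \<noteq> 0"
    using mpol_eval_affine[OF assms, of _ 1 t e] by simp
next
  assume *: "poly (pullback_poly e F) t \<noteq> 0"
  show "nonzero_at F (affine_pt m e t)"
    unfolding nonzero_at_def
  proof
    fix x assume "x \<in> affine_pt m e t"
    then obtain c where "c \<noteq> 0" "\<forall>i\<le>m. x i = c * t ^ e i"
      unfolding affine_pt_def proj_point_def by blast
    then show "mpol_eval (\<lambda>c. c) x F \<noteq> 0"
      using mpol_eval_affine[OF assms, of x c t e] * by simp
  qed
qed

text \<open>Among the monomials of degree d only x_m^d reaches the weight d * e m. Hence the value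
  of a form at infinity is, up to a scalar, its coefficient at that weight.\<close>

lemma wt_le_top:
  assumes "Poly_Mapping.keys \<mu> \<subseteq> {..m}"
  shows "wt e \<mu> \<le> (\<Sum>i\<in>Poly_Mapping.keys \<mu>. Poly_Mapping.lookup \<mu> i) * e m"
    and "wt e \<mu> = (\<Sum>i\<in>Poly_Mapping.keys \<mu>. Poly_Mapping.lookup \<mu> i) * e m \<longleftrightarrow>
      Poly_Mapping.keys \<mu> \<subseteq> {m}"
proof -
  have le: "Poly_Mapping.lookup \<mu> i * e i \<le> Poly_Mapping.lookup \<mu> i * e m"
    if "i \<in> Poly_Mapping.keys \<mu>" for i
    using e_le assms that by auto
  then show "wt e \<mu> \<le> (\<Sum>i\<in>Poly_Mapping.keys \<mu>. Poly_Mapping.lookup \<mu> i) * e m"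
    unfolding wt_def sum_distrib_right by (rule sum_mono)
  show "wt e \<mu> = (\<Sum>i\<in>Poly_Mapping.keys \<mu>. Poly_Mapping.lookup \<mu> i) * e m \<longleftrightarrow>
      Poly_Mapping.keys \<mu> \<subseteq> {m}"
  proof
    assume *: "wt e \<mu> = (\<Sum>i\<in>Poly_Mapping.keys \<mu>. Poly_Mapping.lookup \<mu> i) * e m"
    show "Poly_Mapping.keys \<mu> \<subseteq> {m}"
    proof (rule ccontr)
      assume "\<not> Poly_Mapping.keys \<mu> \<subseteq> {m}"
      then obtain i where i: "i \<in> Poly_Mapping.keys \<mu>" "i \<noteq> m"
        by blast
      then have "i < m"
        using assms by force
      then have "Poly_Mapping.lookup \<mu> i * e i < Poly_Mapping.lookup \<mu> i * e m"
        using e_less[of i m] i by (auto simp: in_keys_iff)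
      then have "wt e \<mu> < (\<Sum>i\<in>Poly_Mapping.keys \<mu>. Poly_Mapping.lookup \<mu> i) * e m"
        unfolding wt_def sum_distrib_right using le i by (intro sum_strict_mono_ex1) auto
      with * show False
        by simp
    qed
  next
    assume "Poly_Mapping.keys \<mu> \<subseteq> {m}"
    then show "wt e \<mu> = (\<Sum>i\<in>Poly_Mapping.keys \<mu>. Poly_Mapping.lookup \<mu> i) * e m"
      unfolding wt_def sum_distrib_right by (intro sum.cong) auto
  qed
qed

lemma mpol_eval_inf:
  assumes "homogeneous m d F" "\<And>i. i \<le> m \<Longrightarrow> x i = c * (if i = m then 1 else 0)"
  shows "mpol_eval (\<lambda>c. c) x F = c ^ d * coeff (pullback_poly e F) (d * e m)"
proof -
  have "(\<Prod>i\<in>Poly_Mapping.keys \<mu>. x i ^ Poly_Mapping.lookup \<mu> i) =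
      (if wt e \<mu> = d * e m then c ^ d else 0)"
    if "\<mu> \<in> Poly_Mapping.keys F" for \<mu>
  proof -
    have \<mu>: "Poly_Mapping.keys \<mu> \<subseteq> {..m}" "(\<Sum>i\<in>Poly_Mapping.keys \<mu>. Poly_Mapping.lookup \<mu> i) = d"
      using assms(1) that unfolding homogeneous_def by auto
    show ?thesis
    proof (cases "Poly_Mapping.keys \<mu> \<subseteq> {m}")
      case True
      then have "(\<Prod>i\<in>Poly_Mapping.keys \<mu>. x i ^ Poly_Mapping.lookup \<mu> i) =
          (\<Prod>i\<in>Poly_Mapping.keys \<mu>. c ^ Poly_Mapping.lookup \<mu> i)"
        using assms(2)[of m] by (intro prod.cong) auto
      also have "\<dots> = c ^ d"
        unfolding \<mu>(2)[symmetric] by (simp add: power_sum)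
      finally show ?thesis
        using wt_le_top(2)[OF \<mu>(1)] \<mu>(2) True by simp
    next
      case False
      then obtain i where i: "i \<in> Poly_Mapping.keys \<mu>" "i \<noteq> m"
        by blast
      then have "x i = 0"
        using assms(2)[of i] \<mu>(1) by auto
      then have "x i ^ Poly_Mapping.lookup \<mu> i = 0"
        using i by (simp add: in_keys_iff)
      then have "(\<Prod>i\<in>Poly_Mapping.keys \<mu>. x i ^ Poly_Mapping.lookup \<mu> i) = 0"
        using i(1) by (intro prod_zero) auto
      then show ?thesis
        using wt_le_top(2)[OF \<mu>(1)] \<mu>(2) False by simp
    qed
  qed
  then have "mpol_eval (\<lambda>c. c) x F = (\<Sum>\<mu>\<in>Poly_Mapping.keys F.
      Poly_Mapping.lookup F \<mu> * (if wt e \<mu> = d * e m then c ^ d else 0))"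
    unfolding mpol_eval_def by simp
  also have "\<dots> = c ^ d * (\<Sum>\<mu>\<in>Poly_Mapping.keys F.
      if wt e \<mu> = d * e m then Poly_Mapping.lookup F \<mu> else 0)"
    unfolding sum_distrib_left by (intro sum.cong) auto
  finally show ?thesis
    by (simp add: pullback_poly_def coeff_sum)
qed

lemma nonzero_at_inf:
  assumes "homogeneous m d F"
  shows "nonzero_at F (inf_pt m) \<longleftrightarrow> coeff (pullback_poly e F) (d * e m) \<noteq> 0"
proof
  assume *: "nonzero_at F (inf_pt m)"
  have "mpol_eval (\<lambda>c. c) (\<lambda>i. if i \<le> m then if i = m then 1 else 0 else 0) F \<noteq> 0"
    using * proj_point_rep[of m "\<lambda>i. if i = m then 1 else 0"] unfolding nonzero_at_def inf_pt_def by blast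
  then show "coeff (pullback_poly e F) (d * e m) \<noteq> 0"
    using mpol_eval_inf[OF assms, of _ 1] by simp
next
  assume *: "coeff (pullback_poly e F) (d * e m) \<noteq> 0"
  show "nonzero_at F (inf_pt m)"
    unfolding nonzero_at_def
  proof
    fix x assume "x \<in> (inf_pt m :: 'a ppoint)"
    then obtain c where "c \<noteq> 0" "\<forall>i\<le>m. x i = c * (if i = m then 1 else 0)"
      unfolding inf_pt_def proj_point_def by blast
    then show "mpol_eval (\<lambda>c. c) x F \<noteq> 0"
      using mpol_eval_inf[OF assms, of x c] * by simp
  qed
qed

lemma pullback_poly_in_form_polys:
  assumes "homogeneous m d F"
  shows "pullback_poly e F \<in> form_polys m e d"
proof -
  have "j \<in> wts m e d" if "coeff (pullback_poly e F) j \<noteq> 0" for j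
  proof -
    have "(\<Sum>\<mu>\<in>Poly_Mapping.keys F. coeff (monom (Poly_Mapping.lookup F \<mu>) (wt e \<mu>)) j) \<noteq> 0"
      using that by (simp add: pullback_poly_def coeff_sum)
    then obtain \<mu> where "\<mu> \<in> Poly_Mapping.keys F" "coeff (monom (Poly_Mapping.lookup F \<mu>) (wt e \<mu>)) j \<noteq> 0"
      by (meson sum.neutral)
    then show ?thesis
      using assms unfolding homogeneous_def wts_def by (auto split: if_splits)
  qed
  then show ?thesis
    by (simp add: form_polys_def)
qed

text \<open>One monomial \<open>M j\<close> of degree d and weight j is chosen for every exponent j
  of p. Different weights force different monomials, so their coefficients can be prescribed
  freely.\<close>

lemma form_poly_is_pullback:
  assumes "p \<in> form_polys m e d"
  obtains F where "homogeneous m d F" "pullback_poly e F = p"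
proof -
  let ?ok = "\<lambda>\<mu>. Poly_Mapping.keys \<mu> \<subseteq> {..m} \<and>
     (\<Sum>i\<in>Poly_Mapping.keys \<mu>. Poly_Mapping.lookup \<mu> i) = d"
  define J where "J = {j. coeff p j \<noteq> 0}"
  have fin: "finite J"
    unfolding J_def by (rule finite_subset[of _ "{..degree p}"]) (auto intro: le_degree)
  have "\<forall>j\<in>J. \<exists>\<mu>. wt e \<mu> = j \<and> ?ok \<mu>"
    using assms unfolding form_polys_def wts_def J_def by blast
  then obtain M where M: "\<And>j. j \<in> J \<Longrightarrow> wt e (M j) = j \<and> ?ok (M j)"
    by metis
  have inj: "inj_on M J"
    using M by (metis inj_onI)
  define c where "c \<mu> = (if \<mu> \<in> M ` J then coeff p (wt e \<mu>) else 0)" for \<mu>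
  have supp: "{\<mu>. c \<mu> \<noteq> 0} = M ` J"
    using M by (auto simp: c_def J_def)
  define F where "F = Abs_poly_mapping c"
  have look: "Poly_Mapping.lookup F = c"
    unfolding F_def using fin supp by (intro lookup_Abs_poly_mapping) simp
  then have keys: "Poly_Mapping.keys F = M ` J"
    using supp by (auto simp: in_keys_iff set_eq_iff)
  have "homogeneous m d F"
    unfolding homogeneous_def keys using M by blast
  moreover have "pullback_poly e F = p"
  proof -
    have "pullback_poly e F = (\<Sum>j\<in>J. monom (c (M j)) (wt e (M j)))"
      unfolding pullback_poly_def keys look using inj by (simp add: sum.reindex)
    also have "\<dots> = (\<Sum>j\<in>J. monom (coeff p j) j)"
      using M by (intro sum.cong) (auto simp: c_def)
    also have "\<dots> = p"
    proof (rule poly_eqI)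
      fix i
      show "coeff (\<Sum>j\<in>J. monom (coeff p j) j) i = coeff p i"
        using fin by (simp add: coeff_sum J_def)
    qed
    finally show ?thesis .
  qed
  ultimately show ?thesis
    using that by blast
qed

lemma structure_sheaf_affine_iff:
  "f \<in> structure_sheaf m e (affine_pt m e t) \<longleftrightarrow>
     (\<exists>p q d. p \<in> form_polys m e d \<and> q \<in> form_polys m e d \<and> poly q t \<noteq> 0 \<and> f = to_fract p / to_fract q)"
  unfolding structure_sheaf_def pullback_eq mem_Collect_eq
  by (metis pullback_poly_in_form_polys form_poly_is_pullback nonzero_at_affine)

lemma structure_sheaf_inf_iff:
  "f \<in> structure_sheaf m e (inf_pt m) \<longleftrightarrow>
     (\<exists>p q d. p \<in> form_polys m e d \<and> q \<in> form_polys m e d \<and> coeff q (d * e m) \<noteq> 0 \<and>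
       f = to_fract p / to_fract q)"
  unfolding structure_sheaf_def pullback_eq mem_Collect_eq
  by (metis pullback_poly_in_form_polys form_poly_is_pullback nonzero_at_inf)

section \<open>Weights of monomials and the numerical semigroup\<close>

lemma wts_le: "j \<in> wts m e d \<Longrightarrow> j \<le> d * e m"
  unfolding wts_def using wt_le_top(1) by blast

text \<open>Replaces the finitely supported exponent \<open>\<mu>\<close> by a plain function summed
  over all indices up to m, for which products of monomials are pointwise sums.\<close>

lemma wts_iff: "j \<in> wts m e d \<longleftrightarrow>
  (\<exists>x. (\<Sum>i\<le>m. x i * e i) = j \<and> (\<Sum>i\<le>m. x i) = d)"
proof
  assume "j \<in> wts m e d"
  then obtain \<mu> where \<mu>: "Poly_Mapping.keys \<mu> \<subseteq> {..m}" "wt e \<mu> = j"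
      "(\<Sum>i\<in>Poly_Mapping.keys \<mu>. Poly_Mapping.lookup \<mu> i) = d"
    unfolding wts_def by blast
  have "(\<Sum>i\<le>m. Poly_Mapping.lookup \<mu> i * e i) = j"
    unfolding \<mu>(2)[symmetric] wt_def using \<mu>(1)
    by (intro sum.mono_neutral_right) (auto simp: in_keys_iff)
  moreover have "(\<Sum>i\<le>m. Poly_Mapping.lookup \<mu> i) = d"
    unfolding \<mu>(3)[symmetric] using \<mu>(1)
    by (intro sum.mono_neutral_right) (auto simp: in_keys_iff)
  ultimately show "\<exists>x. (\<Sum>i\<le>m. x i * e i) = j \<and> (\<Sum>i\<le>m. x i) = d"
    by blast
next
  assume "\<exists>x. (\<Sum>i\<le>m. x i * e i) = j \<and> (\<Sum>i\<le>m. x i) = d"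
  then obtain x where x: "(\<Sum>i\<le>m. x i * e i) = j" "(\<Sum>i\<le>m. x i) = d"
    by blast
  define \<mu> where "\<mu> = Abs_poly_mapping (\<lambda>i. if i \<le> m then x i else 0)"
  have look: "Poly_Mapping.lookup \<mu> = (\<lambda>i. if i \<le> m then x i else 0)"
    unfolding \<mu>_def by (intro lookup_Abs_poly_mapping) (rule finite_subset[of _ "{..m}"], auto)
  then have keys: "Poly_Mapping.keys \<mu> \<subseteq> {..m}"
    by (auto simp: in_keys_iff split: if_splits)
  have "wt e \<mu> = (\<Sum>i\<le>m. Poly_Mapping.lookup \<mu> i * e i)"
    unfolding wt_def using keys by (intro sum.mono_neutral_left) (auto simp: in_keys_iff)
  moreover have "(\<Sum>i\<in>Poly_Mapping.keys \<mu>. Poly_Mapping.lookup \<mu> i) = (\<Sum>i\<le>m. Poly_Mapping.lookup \<mu> i)"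
    using keys by (intro sum.mono_neutral_left) (auto simp: in_keys_iff)
  ultimately show "j \<in> wts m e d"
    unfolding wts_def using x keys by (intro CollectI exI[of _ \<mu>]) (simp add: look)
qed

lemma wts_add: "i \<in> wts m e d \<Longrightarrow> j \<in> wts m e d' \<Longrightarrow> i + j \<in> wts m e (d + d')"
proof -
  assume "i \<in> wts m e d" "j \<in> wts m e d'"
  then obtain x y where "(\<Sum>i\<le>m. x i * e i) = i" "(\<Sum>i\<le>m. x i) = d"
      "(\<Sum>i\<le>m. y i * e i) = j" "(\<Sum>i\<le>m. y i) = d'"
    unfolding wts_iff by blast
  then show ?thesis
    unfolding wts_iff by (intro exI[of _ "\<lambda>i. x i + y i"]) (simp add: sum.distrib algebra_simps)
qed

lemma wts_multiple: "i \<le> m \<Longrightarrow> n * e i \<in> wts m e n"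
  unfolding wts_iff by (intro exI[of _ "\<lambda>j. if j = i then n else 0"]) (simp add: if_distrib[of "\<lambda>x. x * _"] cong: if_cong)

text \<open>Multiplication by x_0^(d' - d) raises the degree and keeps the weight, because e 0 =
  0.\<close>

lemma wts_mono: "j \<in> wts m e d \<Longrightarrow> d \<le> d' \<Longrightarrow> j \<in> wts m e d'"
  using wts_add[of j d 0 "d' - d"] wts_multiple[of 0 "d' - d"] e_0 by simp

text \<open>The witness is x_(m-1)^i * x_m^(d-i): exchanging one x_m for x_(m-1) lowers the weight
  by exactly 1.\<close>

lemma wts_near_top:
  assumes "i \<le> d"
  shows "d * e m - i \<in> wts m e d"
proof -
  have "i * e (m - 1) + (d - i) * e m \<in> wts m e (i + (d - i))"
    by (intro wts_add wts_multiple) simp_all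
  moreover have "i * e (m - 1) + (d - i) * e m + i = d * e m"
    using e_last assms by (metis add.assoc add.commute add_mult_distrib le_add_diff_inverse mult.commute mult_Suc_right Suc_eq_plus1)
  then have "i * e (m - 1) + (d - i) * e m = d * e m - i"
    by simp
  ultimately show ?thesis
    using assms by simp
qed

text \<open>This is the semigroup generated by e 1, ..., e m: x_0 has weight 0, and the union over d
  removes the constraint on the degree.\<close>

definition semigrp :: "nat set" where
  "semigrp = (\<Union>d. wts m e d)"

lemma semigrp_0: "0 \<in> semigrp"
  unfolding semigrp_def using wts_multiple[of 0 0] by auto

lemma semigrp_add: "i \<in> semigrp \<Longrightarrow> j \<in> semigrp \<Longrightarrow> i + j \<in> semigrp"
  unfolding semigrp_def using wts_add by blast

text \<open>Put b = e (m - 1) and write j = q * b + r with r < b. If j is at least b^2, then r < b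
  and b \<le> q, so j = (q - r) * b + r * (b + 1) is a combination of the consecutive generators b
  and e m. For b = 0 the generator e m is 1. The bound b^2 is only an upper bound for the
  conductor.\<close>

lemma semigrp_conductor:
  assumes "e (m - 1) * e (m - 1) \<le> j"
  shows "j \<in> semigrp"
proof -
  define b where "b = e (m - 1)"
  have "\<exists>x y. j = x * b + y * (b + 1)"
  proof (cases "b = 0")
    case False
    then have "j mod b < b" "b \<le> j div b"
      using assms by (simp_all add: b_def less_eq_div_iff_mult_less_eq)
    then have "j = (j div b - j mod b) * b + (j mod b) * (b + 1)"
      by (simp add: algebra_simps diff_mult_distrib flip: mult_le_mono1)
    then show ?thesis
      by blast
  qed (auto intro: exI[of _ j])
  then obtain x y where "j = x * e (m - 1) + y * e m"
    using e_last by (auto simp: b_def)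
  then show ?thesis
    unfolding semigrp_def using wts_add[OF wts_multiple[of "m - 1" x] wts_multiple[of m y]] by auto
qed

text \<open>Numerator and denominator of a function on the curve must have the same degree. Each of
  the finitely many exponents occurs in some degree, and \<open>wts_mono\<close> lifts them all to a
  common one.\<close>

lemma semigrp_poly_in_form_polys:
  fixes p q :: "'k::field poly"
  assumes "\<And>j. coeff p j \<noteq> 0 \<Longrightarrow> j \<in> semigrp" "\<And>j. coeff q j \<noteq> 0 \<Longrightarrow> j \<in> semigrp"
  obtains d where "p \<in> form_polys m e d" "q \<in> form_polys m e d"
proof -
  have *: "\<exists>d. p \<in> form_polys m e d" if "\<And>j. coeff p j \<noteq> 0 \<Longrightarrow> j \<in> semigrp" for p :: "'k poly"
  proof -
    have "\<forall>j. \<exists>d. coeff p j \<noteq> 0 \<longrightarrow> j \<in> wts m e d"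
      using that unfolding semigrp_def by blast
    then obtain d where d: "\<And>j. coeff p j \<noteq> 0 \<Longrightarrow> j \<in> wts m e (d j)"
      by metis
    have "j \<in> wts m e (\<Sum>j\<le>degree p. d j)" if "coeff p j \<noteq> 0" for j
      by (rule wts_mono[OF d[OF that]]) (use that in \<open>auto intro!: member_le_sum le_degree\<close>)
    then show ?thesis
      unfolding form_polys_def by blast
  qed
  obtain d d' where "p \<in> form_polys m e d" "q \<in> form_polys m e d'"
    using *[of p] *[of q] assms by blast
  then have "p \<in> form_polys m e (max d d')" "q \<in> form_polys m e (max d d')"
    unfolding form_polys_def using wts_mono max.cobounded1 max.cobounded2 by blast+
  then show ?thesis
    using that by blast
qed

section \<open>The local rings at the three kinds of points\<close>

lemma structure_sheaf_affine:
  assumes "t \<noteq> (0 :: 'k::field)"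
  shows "structure_sheaf m e (affine_pt m e t) = {f. regular_at t f}"
proof (rule set_eqI, rule iffI)
  fix f assume "f \<in> structure_sheaf m e (affine_pt m e t)"
  then show "f \<in> {f. regular_at t f}"
    unfolding structure_sheaf_affine_iff regular_at_def by blast
next
  fix f assume "f \<in> {f. regular_at t f}"
  then obtain p q where *: "poly q t \<noteq> 0" "f = to_fract p / to_fract q"
    unfolding regular_at_def by blast
  \<comment> \<open>Multiplying numerator and denominator by t^N moves all exponents beyond the
    gaps; this factor does not vanish at the given point, as that is not 0.\<close>
  define N where "N = e (m - 1) * e (m - 1)"
  have "j \<in> semigrp" if "coeff (monom 1 N * r) j \<noteq> 0" for j and r :: "'k poly"
    using that semigrp_conductor[of j] unfolding N_def coeff_monom_mult by (auto split: if_splits)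
  then obtain d where "monom 1 N * p \<in> form_polys m e d" "monom 1 N * q \<in> form_polys m e d"
    by (metis semigrp_poly_in_form_polys)
  moreover have "poly (monom 1 N * q) t \<noteq> 0"
    using * assms by (simp add: poly_monom)
  moreover have "f = to_fract (monom 1 N * p) / to_fract (monom 1 N * q)"
    using *(2) by (simp add: monom_eq_0_iff)
  ultimately show "f \<in> structure_sheaf m e (affine_pt m e t)"
    unfolding structure_sheaf_affine_iff by blast
qed

text \<open>With d the degree of the denominator q, multiplication by t^N with N + d = d * e m moves
  the exponents 0, ..., d onto the top window of weights, where \<open>wts_near_top\<close> applies.
  The leading coefficient of q lands at d * e m, so the new denominator is nonzero at
  infinity.\<close>

lemma structure_sheaf_inf: "structure_sheaf m e (inf_pt m) = {f :: 'k::field poly fract. pole_inf_le 0 f}"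
proof (rule set_eqI, rule iffI)
  fix f :: "'k poly fract" assume "f \<in> structure_sheaf m e (inf_pt m)"
  then obtain p q d where *: "p \<in> form_polys m e d" "coeff q (d * e m) \<noteq> 0" "f = to_fract p / to_fract q"
    unfolding structure_sheaf_inf_iff by blast
  have "degree p \<le> d * e m"
    using *(1) wts_le unfolding form_polys_def by (intro degree_le) force
  also have "d * e m \<le> degree q"
    using *(2) by (rule le_degree)
  finally have "degree p \<le> degree q + 0" "q \<noteq> 0"
    using *(2) by auto
  then show "f \<in> {f. pole_inf_le 0 f}"
    unfolding pole_inf_le_def using *(3) by blast
next
  fix f :: "'k poly fract" assume "f \<in> {f. pole_inf_le 0 f}"
  then obtain p q where *: "q \<noteq> 0" "degree p \<le> degree q" "f = to_fract p / to_fract q"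
    unfolding pole_inf_le_def by auto
  define d where "d = degree q"
  define N where "N = d * e m - d"
  have dN: "N + d = d * e m"
    unfolding N_def using e_pos[OF m_pos] by simp
  have form: "monom 1 N * r \<in> form_polys m e d" if "degree r \<le> d" for r :: "'k poly"
  proof -
    have "j \<in> wts m e d" if "coeff (monom 1 N * r) j \<noteq> 0" for j
    proof -
      have "N \<le> j" "coeff r (j - N) \<noteq> 0"
        using that by (auto simp: coeff_monom_mult split: if_splits)
      then have "N \<le> j" "j - N \<le> d"
        using le_degree[of r "j - N"] \<open>degree r \<le> d\<close> by auto
      then have "j = d * e m - (d - (j - N))"
        using dN by linarith
      then show ?thesis
        using wts_near_top[of "d - (j - N)" d] by simp
    qed
    then show ?thesis
      by (simp add: form_polys_def)
  qed
  have "coeff (monom 1 N * q) (d * e m) \<noteq> 0"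
    unfolding dN[symmetric] coeff_monom_mult using *(1) by (simp add: d_def)
  moreover have "f = to_fract (monom 1 N * p) / to_fract (monom 1 N * q)"
    using *(3) by (simp add: monom_eq_0_iff)
  ultimately show "f \<in> structure_sheaf m e (inf_pt m)"
    unfolding structure_sheaf_inf_iff using form[of p] form[of q] *(2) unfolding d_def by blast
qed

text \<open>A quotient of two series supported in a semigroup is supported in it if the divisor is a unit;
  conversely, every denominator becomes supported in the semigroup after multiplication by a truncation
  of its inverse, which makes it \<open>1\<close> modulo a power beyond the conductor.\<close>

lemma structure_sheaf_cusp: "structure_sheaf m e (affine_pt m e (0 :: 'k::field)) = supp_fun semigrp"
proof (rule set_eqI, rule iffI)
  fix f :: "'k poly fract" assume "f \<in> structure_sheaf m e (affine_pt m e 0)"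
  then obtain p q d where *: "p \<in> form_polys m e d" "q \<in> form_polys m e d" "poly q 0 \<noteq> 0"
      "f = to_fract p / to_fract q"
    unfolding structure_sheaf_affine_iff by blast
  have supp: "r \<in> form_polys m e d \<Longrightarrow> j \<notin> semigrp \<Longrightarrow> coeff r j = 0" for r :: "'k poly" and j
    unfolding form_polys_def semigrp_def by blast
  obtain h where h: "has_expansion f h"
    using *(3,4) regular_imp_has_expansion unfolding regular_at_def by blast
  have "has_expansion (f * to_fract q) (h * fps_of_poly q)"
    by (intro has_expansion_mult h has_expansion_to_fract)
  moreover have "f * to_fract q = to_fract p"
    using * poly_0_nonzero by fastforce
  ultimately have hq: "h * fps_of_poly q = fps_of_poly p"
    using has_expansion_unique has_expansion_to_fract by metis
  \<comment> \<open>Compare coefficients at a gap j in h * q = p. For i < j either i is a gap, and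
    induction applies, or j - i is a gap of the support of q. Only the term with the nonzero
    constant coefficient of q is left.\<close>
  have "fps_nth h j = 0" if "j \<notin> semigrp" for j
    using that
  proof (induction j rule: less_induct)
    case (less j)
    have zero: "fps_nth h i * coeff q (j - i) = 0" if "i < j" for i
    proof (cases "i \<in> semigrp")
      case True
      then have "j - i \<notin> semigrp"
        using semigrp_add[of i "j - i"] that less.prems by auto
      then show ?thesis
        using supp[OF *(2)] by simp
    next
      case False
      then show ?thesis
        using less.IH that by simp
    qed
    have "0 = coeff p j"
      using supp[OF *(1) less.prems] by simp
    also have "\<dots> = fps_nth (h * fps_of_poly q) j"
      unfolding hq by simp
    also have "\<dots> = (\<Sum>i<j. fps_nth h i * coeff q (j - i)) + fps_nth h j * coeff q 0"
      unfolding fps_mult_nth by (simp add: atLeast0AtMost flip: lessThan_Suc_atMost)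
    also have "(\<Sum>i<j. fps_nth h i * coeff q (j - i)) = 0"
      using zero by (intro sum.neutral) blast
    finally show ?case
      using *(3) by (simp add: poly_0_coeff_0)
  qed
  then show "f \<in> supp_fun semigrp"
    unfolding supp_fun_def using h by blast
next
  fix f :: "'k poly fract" assume f: "f \<in> supp_fun semigrp"
  then obtain p q where *: "poly q 0 \<noteq> 0" "f = to_fract p / to_fract q"
    using supp_fun_regular unfolding regular_at_def by blast
  \<comment> \<open>\<open>Suc\<close> keeps N positive even if e (m - 1) = 0, so that the constant
    coefficient of \<open>q * w\<close> is among the controlled ones.\<close>
  define N where "N = Suc (e (m - 1) * e (m - 1))"
  define w where "w = truncate_fps N (inverse (fps_of_poly q))"
  have q0: "coeff q 0 \<noteq> 0"
    using * by (simp add: poly_0_coeff_0)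
  have qw: "coeff (q * w) j = (if j = 0 then 1 else 0)" if "j < N" for j
  proof -
    have "coeff (q * w) j = (\<Sum>i\<le>j. coeff q i * fps_nth (inverse (fps_of_poly q)) (j - i))"
      unfolding coeff_mult w_def using that by (intro sum.cong) (auto simp: coeff_truncate_fps)
    also have "\<dots> = fps_nth (fps_of_poly q * inverse (fps_of_poly q)) j"
      unfolding fps_mult_nth by (simp add: atLeast0AtMost)
    also have "fps_of_poly q * inverse (fps_of_poly q) = 1"
      using q0 by (simp add: inverse_mult_eq_1')
    finally show ?thesis
      by simp
  qed
  have qw_supp: "j \<in> semigrp" if "coeff (q * w) j \<noteq> 0" for j
    using qw[of j] that semigrp_0 semigrp_conductor[of j] unfolding N_def
    by (cases "j < N") (auto simp: N_def split: if_splits)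
  have qw0: "poly (q * w) 0 \<noteq> 0"
    using qw[of 0] unfolding poly_0_coeff_0 N_def by simp
  then have w0: "w \<noteq> 0" "q \<noteq> 0"
    by auto
  \<comment> \<open>The new numerator needs no separate treatment: it is the product of f and
    \<open>q * w\<close>, both supported in the semigroup.\<close>
  have "f * to_fract (q * w) \<in> supp_fun semigrp"
    using f qw_supp
    by (intro supp_fun_mult[of _ semigrp _ semigrp] semigrp_add) (auto simp: supp_fun_to_fract_iff simp del: to_fract_mult)
  moreover have "f * to_fract (q * w) = to_fract (p * w)"
    using *(2) w0 by simp
  ultimately have "\<And>j. coeff (p * w) j \<noteq> 0 \<Longrightarrow> j \<in> semigrp"
    by (auto simp: supp_fun_to_fract_iff simp del: to_fract_mult)
  then obtain d where "p * w \<in> form_polys m e d" "q * w \<in> form_polys m e d"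
    by (metis semigrp_poly_in_form_polys qw_supp)
  moreover have "f = to_fract (p * w) / to_fract (q * w)"
    using *(2) w0 by simp
  ultimately show "f \<in> structure_sheaf m e (affine_pt m e 0)"
    unfolding structure_sheaf_affine_iff using qw0 by blast
qed

end

section \<open>Quotient dimensions\<close>

text \<open>The exchange bound for A/B, stated without quotient spaces: X only has to generate A
  modulo B. Finiteness of Y is part of the conclusion because Y will be an arbitrarily chosen
  complement.\<close>

lemma (in vector_space) complement_finite_card_le:
  assumes B: "subspace B" and X: "finite X" "span (X \<union> B) = A"
    and Y: "independent Y" "span Y \<inter> B = {0}" "span (Y \<union> B) = A"
  shows "finite Y \<and> card Y \<le> card X"
proof -
  have "\<exists>x. x \<in> span X \<and> y - x \<in> B" if "y \<in> Y" for y
  proof -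
    have "y \<in> span (X \<union> B)"
      unfolding X(2) Y(3)[symmetric] using that by (intro span_base) blast
    then obtain x b where "y = x + b" "x \<in> span X" "b \<in> B"
      unfolding span_Un span_eq_iff[THEN iffD2, OF B] by blast
    then show ?thesis
      by (intro exI[of _ x]) simp
  qed
  \<comment> \<open>The representatives modulo \<open>B\<close> of the elements of \<open>Y\<close> in \<open>span X\<close> are still independent.\<close>
  then obtain g where g: "\<And>y. y \<in> Y \<Longrightarrow> g y \<in> span X" "\<And>y. y \<in> Y \<Longrightarrow> y - g y \<in> B"
    by metis
  \<comment> \<open>A relation among the g v puts the same combination of the v into B, and
    \<open>span Y\<close> meets B in 0 only.\<close>
  have key: "u v = 0" if T: "finite T" "T \<subseteq> Y" "(\<Sum>v\<in>T. u v *s g v) = 0" "v \<in> T" for T u v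
  proof -
    have "(\<Sum>v\<in>T. u v *s v) = (\<Sum>v\<in>T. u v *s (v - g v))"
      using T(3) by (simp add: scale_right_diff_distrib sum_subtractf)
    also have "\<dots> \<in> B"
      using g(2) T(2) by (intro subspace_sum[OF B] subspace_scale[OF B]) auto
    finally have "(\<Sum>v\<in>T. u v *s v) \<in> span Y \<inter> B"
      using T(2) by (auto intro!: span_sum span_scale intro: span_base)
    then show ?thesis
      using Y(2) independentD[OF Y(1) T(1,2) _ T(4), of u] by simp
  qed
  have inj: "inj_on g Y"
  proof (rule inj_onI, rule ccontr)
    fix x y assume xy: "x \<in> Y" "y \<in> Y" "g x = g y" "x \<noteq> y"
    \<comment> \<open>The coefficients 1 at x and -1 at y express the relation g x - g y =
      0.\<close>
    have "(\<lambda>v. if v = x then 1 else - 1) x = (0 :: 'a)"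
      by (rule key[of "{x, y}"]) (use xy in auto)
    then show False
      by simp
  qed
  have "independent (g ` Y)"
    unfolding independent_explicit_finite_subsets
  proof (intro allI impI ballI)
    fix S u v assume S: "S \<subseteq> g ` Y" "finite S" "(\<Sum>v\<in>S. u v *s v) = 0" "v \<in> S"
    obtain T where T: "T \<subseteq> Y" "finite T" "S = g ` T"
      using finite_subset_image[OF S(2,1)] by blast
    have "inj_on g T"
      using inj T(1) by (rule inj_on_subset)
    then have "(\<Sum>w\<in>T. u (g w) *s g w) = 0"
      using S(3) unfolding T(3) by (simp add: sum.reindex)
    moreover obtain w where "w \<in> T" "v = g w"
      using S(4) T(3) by blast
    ultimately show "u v = 0"
      using key[OF T(2,1), of "\<lambda>w. u (g w)" w] by simp
  qed
  then have "finite (g ` Y) \<and> card (g ` Y) \<le> card X"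
    using X(1) g(1) by (intro independent_span_bound) auto
  then show ?thesis
    using inj by (simp add: card_image finite_image_iff)
qed

text \<open>The bound is used in both directions, between X and the complement that the definition
  chooses.\<close>

lemma quotient_dim_eq_card:
  assumes "fam.subspace B" "finite X" "fam.independent X" "fam.span X \<inter> B = {0}"
    "fam.span (X \<union> B) = A"
  shows "quotient_dim A B = card X"
proof -
  define Y where "Y = (SOME X. fam.independent X \<and> fam.span X \<inter> B = {0} \<and> fam.span (X \<union> B) = A)"
  have Y: "fam.independent Y \<and> fam.span Y \<inter> B = {0} \<and> fam.span (Y \<union> B) = A"
    unfolding Y_def by (rule someI[of _ X]) (use assms in blast)
  have "finite Y" "card Y \<le> card X"
    using fam.complement_finite_card_le[OF assms(1,2,5)] Y by blast+
  moreover from this(1) have "card X \<le> card Y"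
    using fam.complement_finite_card_le[OF assms(1), of Y A X] Y assms(3-5) by blast
  ultimately show ?thesis
    by (simp add: quotient_dim_def Y_def)
qed

lemma t_pow_inj: "t_pow i = (t_pow j :: 'k::field poly fract) \<longleftrightarrow> i = j"
proof
  assume "t_pow i = (t_pow j :: 'k poly fract)"
  then have "degree (monom 1 i :: 'k poly) = degree (monom 1 j :: 'k poly)"
    by (simp add: t_pow_def)
  then show "i = j"
    by (simp add: degree_monom_eq)
qed simp

lemma scale_kt_t_pow: "scale_kt c (t_pow j) = to_fract (monom c j)"
  by (simp add: scale_kt_def const_kt_t_pow)

lemma sum_fun_apply: "(\<Sum>i\<in>A. f i) x = (\<Sum>i\<in>A. f i x)"
  by (induction A rule: infinite_finite_induct) simp_all

section \<open>Cohomology of monomial sheaves\<close>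

context monomial_exponents
begin

text \<open>The common shape of both sheaves, so that cohomology is computed once: D is the
  semigroup and N = 0 for the structure sheaf, while D is the union of S and E and N = a n for the
  generated one.\<close>

definition monomial_sheaf :: "nat set \<Rightarrow> nat \<Rightarrow> 'k::field rsheaf \<Rightarrow> bool" where
  "monomial_sheaf D N \<F> \<longleftrightarrow>
     (\<forall>t. t \<noteq> 0 \<longrightarrow> \<F> (affine_pt m e t) = {f. regular_at t f}) \<and>
     \<F> (affine_pt m e 0) = supp_fun D \<and> \<F> (inf_pt m) = {f. pole_inf_le N f}"

lemma curve_cases:
  assumes "R \<in> monomial_curve m e"
  obtains "R = inf_pt m" | "R = affine_pt m e 0" | t where "t \<noteq> 0" "R = affine_pt m e (t :: 'k::field)"
  using assms that unfolding monomial_curve_eq by (metis insertE rangeE)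

lemma monomial_sheaf_stalk_subspace:
  assumes "monomial_sheaf D N \<F>" "R \<in> monomial_curve m e"
  shows "kt.subspace (\<F> R)"
  using assms(2)
proof (cases rule: curve_cases)
  case 1
  then show ?thesis
    using assms(1) pole_inf_le_subspace by (simp add: monomial_sheaf_def)
next
  case 2
  then show ?thesis
    using assms(1) supp_fun_subspace by (simp add: monomial_sheaf_def)
next
  case (3 t)
  then show ?thesis
    using assms(1) regular_at_subspace by (simp add: monomial_sheaf_def)
qed

section \<open>Global sections\<close>

lemma monomial_sheaf_sections:
  fixes \<F> :: "'k::alg_closed_field rsheaf"
  assumes "monomial_sheaf D N \<F>"
  shows "sections \<F> (monomial_curve m e) =
    {to_fract p | p. degree p \<le> N \<and> (\<forall>j. j \<notin> D \<longrightarrow> coeff p j = 0)}"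
proof (rule set_eqI, rule iffI)
  fix f assume "f \<in> sections \<F> (monomial_curve m e)"
  then have f: "f \<in> \<F> R" if "R \<in> monomial_curve m e" for R
    using that by (simp add: sections_def)
  have f0: "f \<in> supp_fun D"
    using f[of "affine_pt m e 0"] assms by (simp add: monomial_curve_eq monomial_sheaf_def)
  have "regular_at t f" for t
    using f[of "affine_pt m e t"] assms supp_fun_regular[OF f0]
    by (cases "t = 0") (auto simp: monomial_curve_eq monomial_sheaf_def)
  then obtain p where p: "f = to_fract p"
    using regular_everywhere_imp_poly by blast
  have "pole_inf_le N f"
    using f[of "inf_pt m"] assms by (simp add: monomial_curve_eq monomial_sheaf_def)
  then show "f \<in> {to_fract p | p. degree p \<le> N \<and> (\<forall>j. j \<notin> D \<longrightarrow> coeff p j = 0)}"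
    using f0 pole_inf_le_to_fractD unfolding p supp_fun_to_fract_iff by blast
next
  fix f :: "'k poly fract"
  assume "f \<in> {to_fract p | p. degree p \<le> N \<and> (\<forall>j. j \<notin> D \<longrightarrow> coeff p j = 0)}"
  then obtain p where p: "f = to_fract p" "degree p \<le> N" "\<forall>j. j \<notin> D \<longrightarrow> coeff p j = 0"
    by blast
  have "f \<in> \<F> R" if "R \<in> monomial_curve m e" for R
    using that
  proof (cases rule: curve_cases)
    case 1
    then show ?thesis
      using assms p pole_inf_le_to_fract by (auto simp: monomial_sheaf_def)
  next
    case 2
    then show ?thesis
      using assms p by (simp add: monomial_sheaf_def supp_fun_to_fract_iff)
  next
    case (3 t)
    then show ?thesis
      using assms p regular_at_to_fract by (simp add: monomial_sheaf_def)
  qed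
  then show "f \<in> sections \<F> (monomial_curve m e)"
    by (simp add: sections_def)
qed

lemma t_pow_independent:
  assumes "finite J"
  shows "kt.independent (t_pow ` J :: 'k::field poly fract set)"
proof -
  have "u v = 0" if u: "(\<Sum>v\<in>t_pow ` J. scale_kt (u v) v) = 0" and v: "v \<in> t_pow ` J"
    for u and v :: "'k poly fract"
  proof -
    obtain i where i: "v = t_pow i" "i \<in> J"
      using v by blast
    have "(\<Sum>v\<in>t_pow ` J. scale_kt (u v) v) = to_fract (\<Sum>j\<in>J. monom (u (t_pow j)) j)"
      by (simp add: sum.reindex inj_on_def t_pow_inj scale_kt_t_pow)
    then have "(\<Sum>j\<in>J. monom (u (t_pow j)) j) = 0"
      using u by (metis to_fract_eq_0_iff)
    then have "coeff (\<Sum>j\<in>J. monom (u (t_pow j)) j) i = 0"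
      by simp
    then show ?thesis
      using assms i by (simp add: coeff_sum)
  qed
  then show ?thesis
    using assms unfolding kt.dependent_finite[OF finite_imageI[OF assms]] by blast
qed

lemma h0_monomial_sheaf:
  fixes \<F> :: "'k::alg_closed_field rsheaf"
  assumes "monomial_sheaf D N \<F>"
  shows "h0 m e \<F> = card (D \<inter> {..N})"
  unfolding h0_def
proof (rule kt.dim_unique)
  let ?X = "t_pow ` (D \<inter> {..N}) :: 'k poly fract set"
  show "?X \<subseteq> sections \<F> (monomial_curve m e)"
    unfolding monomial_sheaf_sections[OF assms] t_pow_def by (force simp: degree_monom_eq)
  show "sections \<F> (monomial_curve m e) \<subseteq> kt.span ?X"
  proof
    fix f assume "f \<in> sections \<F> (monomial_curve m e)"
    then obtain p where p: "f = to_fract p" "degree p \<le> N" "\<forall>j. j \<notin> D \<longrightarrow> coeff p j = 0"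
      unfolding monomial_sheaf_sections[OF assms] by blast
    have "f = (\<Sum>j\<le>N. scale_kt (coeff p j) (t_pow j))"
      unfolding p(1) by (subst poly_as_sum_of_monoms'[OF p(2), symmetric]) (simp add: scale_kt_t_pow)
    also have "\<dots> \<in> kt.span ?X"
    proof (rule kt.span_sum)
      fix j assume "j \<in> {..N}"
      then show "scale_kt (coeff p j) (t_pow j) \<in> kt.span ?X"
        using p(3) by (cases "j \<in> D") (auto intro!: kt.span_scale intro: kt.span_base simp: kt.span_zero)
    qed
    finally show "f \<in> kt.span ?X" .
  qed
  show "kt.independent ?X"
    by (intro t_pow_independent) simp
  show "card ?X = card (D \<inter> {..N})"
    by (intro card_image) (simp add: inj_on_def t_pow_inj)
qed

text \<open>For \<open>j > N\<close> outside \<open>D\<close>, these families represent a basis of the first cohomology of the sheaf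
  with support \<open>D\<close> at the cusp and pole order \<open>N\<close> at infinity.\<close>

definition skyscraper :: "nat \<Rightarrow> 'k::field ppoint \<Rightarrow> 'k poly fract" where
  "skyscraper j = (\<lambda>R. if R = affine_pt m e 0 then t_pow j else 0)"

lemma skyscraper_inj: "inj_on skyscraper J"
proof (rule inj_onI)
  fix i j assume "skyscraper i = (skyscraper j :: 'k::field ppoint \<Rightarrow> _)"
  from fun_cong[OF this, of "affine_pt m e 0"] show "i = j"
    by (simp add: skyscraper_def t_pow_inj)
qed

lemma skyscraper_sum:
  "(\<Sum>j\<in>J. scale_fam (c j) (skyscraper j)) =
     (\<lambda>R. if R = affine_pt m e 0 then to_fract (\<Sum>j\<in>J. monom (c j) j) else 0)"
  by (rule ext) (simp add: sum_fun_apply scale_fam_def skyscraper_def scale_kt_t_pow)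

lemma skyscraper_span:
  assumes "finite J"
  shows "fam.span (skyscraper ` J :: ('k::field ppoint \<Rightarrow> 'k poly fract) set) =
    range (\<lambda>c. \<Sum>j\<in>J. scale_fam (c j) (skyscraper j))"
proof (rule subset_antisym)
  show "fam.span (skyscraper ` J :: ('k ppoint \<Rightarrow> 'k poly fract) set) \<subseteq>
      range (\<lambda>c. \<Sum>j\<in>J. scale_fam (c j) (skyscraper j))"
    unfolding fam.span_finite[OF finite_imageI[OF assms]]
  proof (rule image_subsetI)
    fix u :: "('k ppoint \<Rightarrow> 'k poly fract) \<Rightarrow> 'k"
    have "(\<Sum>v\<in>skyscraper ` J. scale_fam (u v) v) =
        (\<Sum>j\<in>J. scale_fam (u (skyscraper j)) (skyscraper j))"
      by (simp add: sum.reindex skyscraper_inj)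
    then show "(\<Sum>v\<in>skyscraper ` J. scale_fam (u v) v) \<in>
        range (\<lambda>c. \<Sum>j\<in>J. scale_fam (c j) (skyscraper j))"
      by (rule range_eqI[where x = "\<lambda>j. u (skyscraper j)"])
  qed
  show "range (\<lambda>c. \<Sum>j\<in>J. scale_fam (c j) (skyscraper j)) \<subseteq>
      fam.span (skyscraper ` J :: ('k ppoint \<Rightarrow> 'k poly fract) set)"
    by (intro image_subsetI fam.span_sum fam.span_scale fam.span_base) simp
qed

section \<open>First cohomology: families modulo global ones\<close>

lemma global_families_subspace:
  assumes "monomial_sheaf D N \<F>"
  shows "fam.subspace (global_families m e \<F>)"
proof (rule fam.subspaceI)
  note sub = monomial_sheaf_stalk_subspace[OF assms]
  have "(0 :: 'a ppoint \<Rightarrow> _) Q - 0 \<in> \<F> Q" if "Q \<in> monomial_curve m e" for Q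
    using kt.subspace_0[OF sub[OF that]] by simp
  then show "0 \<in> global_families m e \<F>"
    unfolding global_families_def by blast
next
  note sub = monomial_sheaf_stalk_subspace[OF assms]
  fix r s assume "r \<in> global_families m e \<F>" "s \<in> global_families m e \<F>"
  then obtain f g where fg: "\<And>Q. Q \<in> monomial_curve m e \<Longrightarrow> r Q - f \<in> \<F> Q"
      "\<And>Q. Q \<in> monomial_curve m e \<Longrightarrow> s Q - g \<in> \<F> Q"
    unfolding global_families_def by blast
  have "(r + s) Q - (f + g) \<in> \<F> Q" if "Q \<in> monomial_curve m e" for Q
    using kt.subspace_add[OF sub[OF that] fg(1)[OF that] fg(2)[OF that]] by (simp add: algebra_simps)
  then show "r + s \<in> global_families m e \<F>"
    unfolding global_families_def by blast
next
  note sub = monomial_sheaf_stalk_subspace[OF assms]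
  fix c s assume "s \<in> global_families m e \<F>"
  then obtain f where f: "\<And>Q. Q \<in> monomial_curve m e \<Longrightarrow> s Q - f \<in> \<F> Q"
    unfolding global_families_def by blast
  have "scale_fam c s Q - scale_kt c f \<in> \<F> Q" if "Q \<in> monomial_curve m e" for Q
    using kt.subspace_scale[OF sub[OF that] f[OF that], of c]
    by (simp add: scale_fam_def kt.scale_right_diff_distrib)
  then show "scale_fam c s \<in> global_families m e \<F>"
    unfolding global_families_def by blast
qed

text \<open>A form that is nonzero at infinity pulls back to a nonzero polynomial, and outside U
  only its finitely many roots can lie.\<close>

lemma zariski_open_cofinite:
  assumes "zariski_open m e U" "inf_pt m \<in> U"
  shows "finite {t :: 'k::field. affine_pt m e t \<notin> U}"
proof -
  obtain I where I: "\<forall>G\<in>I. \<exists>d. homogeneous m d G" "U = {R \<in> monomial_curve m e. \<exists>G\<in>I. nonzero_at G R}"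
    using assms(1) unfolding zariski_open_def by blast
  then obtain G d where G: "G \<in> I" "nonzero_at G (inf_pt m)" "homogeneous m d G"
    using assms(2) by blast
  have "pullback_poly e G \<noteq> 0"
    using G(2) unfolding nonzero_at_inf[OF G(3)] by auto
  then have "finite {t. poly (pullback_poly e G) t = 0}"
    by (rule poly_roots_finite)
  moreover have "{t. affine_pt m e t \<notin> U} \<subseteq> {t. poly (pullback_poly e G) t = 0}"
    using G(1) nonzero_at_affine[OF G(3)] unfolding I(2) monomial_curve_eq by blast
  ultimately show ?thesis
    by (rule rev_finite_subset)
qed

lemma zariski_open_variable:
  assumes "i \<le> m"
  shows "zariski_open m e {R \<in> monomial_curve m e.
    nonzero_at (Poly_Mapping.single (Poly_Mapping.single i 1) (1 :: 'k::field)) R}"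
  unfolding zariski_open_def using homogeneous_variable[OF assms] by blast

text \<open>This is the locus where x_0 is nonzero. Together with the complement of the cusp, where
  x_m is nonzero, it covers the curve and serves to show that skyscraper families are locally given
  by one function.\<close>

lemma zariski_open_affine: "zariski_open m e (range (affine_pt m e :: 'k::field \<Rightarrow> _))"
proof -
  have "nonzero_at (Poly_Mapping.single (Poly_Mapping.single 0 1) (1 :: 'k)) (affine_pt m e t)" for t
    unfolding nonzero_at_affine[OF homogeneous_variable[OF le0]] pullback_poly_variable
    by (simp add: poly_monom e_0)
  moreover have "\<not> nonzero_at (Poly_Mapping.single (Poly_Mapping.single 0 1) (1 :: 'k)) (inf_pt m)"
    unfolding nonzero_at_inf[OF homogeneous_variable[OF le0]] pullback_poly_variable
    using e_pos[OF m_pos] by (simp add: e_0)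
  ultimately have "range (affine_pt m e :: 'k \<Rightarrow> _) = {R \<in> monomial_curve m e.
      nonzero_at (Poly_Mapping.single (Poly_Mapping.single 0 1) (1 :: 'k)) R}"
    unfolding monomial_curve_eq by auto
  then show ?thesis
    using zariski_open_variable[of 0] by simp
qed

lemma zariski_open_remove_cusp:
  "zariski_open m e (monomial_curve m e - {affine_pt m e (0 :: 'k::field)})"
proof -
  let ?G = "Poly_Mapping.single (Poly_Mapping.single m 1) (1 :: 'k)"
  have "nonzero_at ?G (affine_pt m e t) \<longleftrightarrow> t \<noteq> 0" for t
    unfolding nonzero_at_affine[OF homogeneous_variable[OF order_refl]] pullback_poly_variable
    using e_pos[OF m_pos] by (simp add: poly_monom)
  moreover have "nonzero_at ?G (inf_pt m)"
    unfolding nonzero_at_inf[OF homogeneous_variable[OF order_refl]] pullback_poly_variable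
    by simp
  ultimately have "monomial_curve m e - {affine_pt m e (0 :: 'k)} =
      {R \<in> monomial_curve m e. nonzero_at ?G R}"
    unfolding monomial_curve_eq using affine_ne_inf affine_pt_inj by (auto simp: image_iff)
  then show ?thesis
    using zariski_open_variable[of m] by simp
qed

text \<open>A function f representing the family is a polynomial q: it has no affine poles, and
  infinity bounds its degree by N. At the cusp p - q is supported in D. An index i > N outside D
  therefore sees neither q nor p - q, so the coefficient of p vanishes.\<close>

lemma skyscraper_sum_global_imp_zero:
  fixes \<F> :: "'k::alg_closed_field rsheaf"
  assumes F: "monomial_sheaf D N \<F>" and J: "finite J" "J = {N<..} - D"
    and global: "(\<Sum>j\<in>J. scale_fam (c j) (skyscraper j)) \<in> global_families m e \<F>"
    and i: "i \<in> J"
  shows "c i = 0"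
proof -
  define p where "p = (\<Sum>j\<in>J. monom (c j) j)"
  obtain f where f: "\<And>Q. Q \<in> monomial_curve m e \<Longrightarrow>
      (if Q = affine_pt m e 0 then to_fract p else 0) - f \<in> \<F> Q"
    using global unfolding global_families_def skyscraper_sum p_def by auto
  have f0: "to_fract p - f \<in> supp_fun D"
    using f[of "affine_pt m e 0"] F by (simp add: monomial_curve_eq monomial_sheaf_def)
  have "regular_at t f" for t
  proof (cases "t = 0")
    case True
    have "f = to_fract p - (to_fract p - f)"
      by simp
    then show ?thesis
      using kt.subspace_diff[OF regular_at_subspace[of 0], of "to_fract p" "to_fract p - f"]
        supp_fun_regular[OF f0] True by (simp add: regular_at_to_fract)
  next
    case False
    then have "regular_at t (- f)"
      using f[of "affine_pt m e t"] F
      by (simp add: monomial_curve_eq monomial_sheaf_def affine_pt_inj)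
    then show ?thesis
      using kt.subspace_neg[OF regular_at_subspace[of t], of "- f"] by simp
  qed
  then obtain q where q: "f = to_fract q"
    using regular_everywhere_imp_poly by blast
  have "pole_inf_le N (- f)"
    using f[of "inf_pt m"] F
    by (simp add: monomial_curve_eq monomial_sheaf_def affine_ne_inf[symmetric])
  then have "pole_inf_le N (to_fract q)"
    using kt.subspace_neg[OF pole_inf_le_subspace[of N], of "- f"] q by simp
  then have "coeff q i = 0"
    using i J(2) pole_inf_le_to_fractD by (intro coeff_eq_0) fastforce
  moreover have "coeff (p - q) i = 0"
  proof -
    have "to_fract (p - q) \<in> supp_fun D"
      using f0 q by simp
    then show ?thesis
      using i J(2) unfolding supp_fun_to_fract_iff by blast
  qed
  moreover have "coeff p i = c i"
    using i J(1) by (simp add: p_def coeff_sum)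
  ultimately show ?thesis
    by simp
qed

text \<open>The local function \<open>f0\<close> near infinity serves at all but finitely many
  points; principal parts correct it to \<open>f1\<close>, which leaves a regular difference at
  every affine point and the right pole order at infinity. Only the support condition at the cusp
  remains to be repaired.\<close>

lemma quotient_section_decomposition:
  fixes \<F> :: "'k::field rsheaf"
  assumes F: "monomial_sheaf D N \<F>" and J: "J = {N<..} - D" and cofin: "{C..} \<subseteq> D"
    and s: "s \<in> quotient_section_families m e \<F>"
  shows "\<exists>c. s - (\<Sum>j\<in>J. scale_fam (c j) (skyscraper j)) \<in> global_families m e \<F>"
proof -
  obtain U f0 where U: "zariski_open m e U" "inf_pt m \<in> U" "\<And>Q. Q \<in> U \<Longrightarrow> s Q - f0 \<in> \<F> Q"
    using s unfolding quotient_section_families_def monomial_curve_eq by blast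
  define Z where "Z = {t. affine_pt m e t \<notin> U}"
  have "finite Z"
    unfolding Z_def using U(1,2) by (rule zariski_open_cofinite)
  from principal_parts[OF this, of "\<lambda>t. s (affine_pt m e t) - f0"]
  obtain g where g: "\<And>t. t \<in> Z \<Longrightarrow> regular_at t (s (affine_pt m e t) - f0 - g)"
      "\<And>t. t \<notin> Z \<Longrightarrow> regular_at t g" "pole_inf_le 0 g"
    by blast
  define f1 where "f1 = f0 + g"
  have reg: "regular_at t (s (affine_pt m e t) - f1)" for t
  proof (cases "t \<in> Z")
    case True
    then show ?thesis
      using g(1) by (simp add: f1_def diff_diff_eq)
  next
    case False
    then have "s (affine_pt m e t) - f0 \<in> \<F> (affine_pt m e t)"
      using U(3) by (simp add: Z_def)
    then have "regular_at t (s (affine_pt m e t) - f0)"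
      using F supp_fun_regular by (cases "t = 0") (auto simp: monomial_sheaf_def)
    then show ?thesis
      using kt.subspace_diff[OF regular_at_subspace[of t], of "s (affine_pt m e t) - f0" g] g(2)[OF False]
      by (simp add: f1_def diff_diff_eq)
  qed
  have inf: "pole_inf_le N (s (inf_pt m) - f1)"
  proof -
    have "pole_inf_le N (s (inf_pt m) - f0)"
      using U(2,3) F by (auto simp: monomial_sheaf_def)
    moreover have "pole_inf_le N g"
      using g(3) pole_inf_le_mono by blast
    ultimately show ?thesis
      using kt.subspace_diff[OF pole_inf_le_subspace[of N], of "s (inf_pt m) - f0" g]
      by (simp add: f1_def diff_diff_eq)
  qed
  have "s (affine_pt m e 0) - f1 \<in> supp_fun UNIV"
    using reg[of 0] regular_imp_has_expansion unfolding supp_fun_def by blast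
  then obtain c where c:
      "s (affine_pt m e 0) - f1 - (\<Sum>j<C. scale_kt (c j) (t_pow j)) \<in> supp_fun {C..}"
    by (rule supp_fun_finite_part[where N = C])
  \<comment> \<open>The Taylor coefficients below C are divided by how they disappear: those in L
    form a polynomial of degree at most N, which can be added to the global function; those in M
    have exponents in D and belong to the stalk at the cusp; those in J remain as
    skyscrapers.\<close>
  define L where "L = {..<C} \<inter> {..N}"
  define M where "M = {..<C} \<inter> {N<..} \<inter> D"
  have JC: "J \<subseteq> {..<C}"
    using cofin by (auto simp: J not_le[symmetric])
  have split: "{..<C} = L \<union> (M \<union> J)" "L \<inter> (M \<union> J) = {}" "M \<inter> J = {}"
    using JC by (auto simp: L_def M_def J)
  have fin: "finite L" "finite M" "finite J"
    using JC finite_subset by (auto simp: L_def M_def)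
  define p where "p A = (\<Sum>j\<in>A. monom (c j) j)" for A
  have psum: "(\<Sum>j\<in>A. scale_kt (c j) (t_pow j)) = to_fract (p A)" for A
    by (simp add: p_def scale_kt_t_pow)
  have pC: "p {..<C} = p L + (p M + p J)"
    unfolding p_def split(1) using fin split(2,3) by (simp add: sum.union_disjoint)
  define f where "f = f1 + to_fract (p L)"
  have "s Q - (if Q = affine_pt m e 0 then to_fract (p J) else 0) - f \<in> \<F> Q"
    if "Q \<in> monomial_curve m e" for Q
    using that
  proof (cases rule: curve_cases)
    case 1
    have "degree (p L) \<le> N"
      unfolding p_def by (intro degree_sum_le fin) (auto simp: L_def intro: order_trans[OF degree_monom_le])
    then have "pole_inf_le N (s (inf_pt m) - f1 - to_fract (p L))"
      using kt.subspace_diff[OF pole_inf_le_subspace[of N]] inf pole_inf_le_to_fract by blast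
    then show ?thesis
      using 1 F by (simp add: monomial_sheaf_def f_def diff_diff_eq affine_ne_inf[symmetric])
  next
    case 2
    have "s (affine_pt m e 0) - f1 - to_fract (p {..<C}) \<in> supp_fun D"
      using c supp_fun_mono[OF cofin] unfolding psum by blast
    moreover have "to_fract (p M) \<in> supp_fun D"
      unfolding supp_fun_to_fract_iff p_def using fin by (auto simp: coeff_sum M_def)
    ultimately have "s (affine_pt m e 0) - f1 - to_fract (p {..<C}) + to_fract (p M) \<in> supp_fun D"
      by (rule kt.subspace_add[OF supp_fun_subspace])
    then show ?thesis
      using 2 F by (simp add: monomial_sheaf_def f_def pC algebra_simps)
  next
    case (3 t)
    then have "regular_at t (s Q - f1 - to_fract (p L))"
      using kt.subspace_diff[OF regular_at_subspace[of t]] reg regular_at_to_fract by blast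
    then show ?thesis
      using 3 F by (simp add: monomial_sheaf_def f_def diff_diff_eq affine_pt_inj)
  qed
  then have "s - (\<Sum>j\<in>J. scale_fam (c j) (skyscraper j)) \<in> global_families m e \<F>"
    unfolding global_families_def skyscraper_sum p_def fun_diff_def by blast
  then show ?thesis
    by blast
qed

text \<open>Around the cusp the local function is f + p: at the other affine points the polynomial p
  is regular and hence lies in the stalk. Off the cusp the skyscraper part is 0 and f itself
  works.\<close>

lemma skyscraper_sum_add_global:
  fixes \<F> :: "'k::field rsheaf"
  assumes F: "monomial_sheaf D N \<F>" and b: "b \<in> global_families m e \<F>"
  shows "(\<Sum>j\<in>J. scale_fam (c j) (skyscraper j)) + b \<in> quotient_section_families m e \<F>"
proof -
  define p where "p = (\<Sum>j\<in>J. monom (c j) j)"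
  define x where "x = (\<Sum>j\<in>J. scale_fam (c j) (skyscraper j))"
  have x: "x = (\<lambda>R. if R = affine_pt m e 0 then to_fract p else 0)"
    unfolding x_def p_def by (rule skyscraper_sum)
  obtain f where f: "\<And>Q. Q \<in> monomial_curve m e \<Longrightarrow> b Q - f \<in> \<F> Q"
    using b unfolding global_families_def by blast
  have "\<exists>U f. zariski_open m e U \<and> R \<in> U \<and> (\<forall>Q\<in>U. (x + b) Q - f \<in> \<F> Q)"
    if R: "R \<in> monomial_curve m e" for R
  proof (cases "R = affine_pt m e 0")
    case True
    have "(x + b) Q - (f + to_fract p) \<in> \<F> Q" if Q: "Q \<in> range (affine_pt m e)" for Q
    proof (cases "Q = affine_pt m e 0")
      case True
      then show ?thesis
        using f[of Q] by (simp add: x monomial_curve_eq)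
    next
      case False
      obtain t where t: "Q = affine_pt m e t"
        using Q by blast
      with False have "t \<noteq> 0"
        by blast
      then have FQ: "\<F> Q = {f. regular_at t f}"
        using F t by (simp add: monomial_sheaf_def)
      have "regular_at t (b Q - f - to_fract p)"
        using f[of Q] t kt.subspace_diff[OF regular_at_subspace[of t]] regular_at_to_fract
        unfolding FQ by (auto simp: monomial_curve_eq)
      then show ?thesis
        unfolding FQ using False by (simp add: x diff_diff_eq)
    qed
    then show ?thesis
      using zariski_open_affine True by blast
  next
    case False
    have "(x + b) Q - f \<in> \<F> Q" if "Q \<in> monomial_curve m e - {affine_pt m e 0}" for Q
      using that f[of Q] by (simp add: x)
    then show ?thesis
      using zariski_open_remove_cusp R False by blast
  qed
  then show ?thesis
    unfolding quotient_section_families_def x_def by blast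
qed

lemma h1_monomial_sheaf:
  fixes \<F> :: "'k::alg_closed_field rsheaf"
  assumes F: "monomial_sheaf D N \<F>" and cofin: "{C..} \<subseteq> D"
  shows "h1 m e \<F> = card ({N<..} - D)"
proof -
  define J where "J = {N<..} - D"
  have "J \<subseteq> {..<C}"
    using cofin by (auto simp: J_def not_le[symmetric])
  then have fin: "finite J"
    using finite_subset by blast
  let ?X = "skyscraper ` J :: ('k ppoint \<Rightarrow> 'k poly fract) set"
  let ?B = "global_families m e \<F>"
  note sub = global_families_subspace[OF F]
  note zero = skyscraper_sum_global_imp_zero[OF F fin J_def]
  have "h1 m e \<F> = card ?X"
    unfolding h1_def
  proof (rule quotient_dim_eq_card)
    show "fam.independent ?X"
      unfolding fam.dependent_finite[OF finite_imageI[OF fin]]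
    proof clarify
      fix u j assume u: "(\<Sum>v\<in>?X. scale_fam (u v) v) = 0" and j: "j \<in> J" "u (skyscraper j) \<noteq> 0"
      have "(\<Sum>j\<in>J. scale_fam (u (skyscraper j)) (skyscraper j)) \<in> ?B"
        using u fam.subspace_0[OF sub] by (simp add: sum.reindex skyscraper_inj)
      then show False
        using zero[of "\<lambda>j. u (skyscraper j)" j] j by simp
    qed
    show "fam.span ?X \<inter> ?B = {0}"
    proof (rule subset_antisym)
      show "fam.span ?X \<inter> ?B \<subseteq> {0}"
        unfolding skyscraper_span[OF fin] using zero by (auto intro!: sum.neutral)
      show "{0} \<subseteq> fam.span ?X \<inter> ?B"
        using fam.subspace_0[OF sub] fam.span_zero by blast
    qed
    show "fam.span (?X \<union> ?B) = quotient_section_families m e \<F>"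
    proof (rule set_eqI, rule iffI)
      fix s assume "s \<in> fam.span (?X \<union> ?B)"
      then obtain x b where "s = x + b" "x \<in> fam.span ?X" "b \<in> ?B"
        unfolding fam.span_Un fam.span_eq_iff[THEN iffD2, OF sub] by blast
      then show "s \<in> quotient_section_families m e \<F>"
        unfolding skyscraper_span[OF fin] using skyscraper_sum_add_global[OF F] by blast
    next
      fix s assume "s \<in> quotient_section_families m e \<F>"
      then obtain c where "s - (\<Sum>j\<in>J. scale_fam (c j) (skyscraper j)) \<in> ?B"
        using quotient_section_decomposition[OF F J_def cofin] by blast
      then have "s - (\<Sum>j\<in>J. scale_fam (c j) (skyscraper j)) \<in> fam.span (?X \<union> ?B)"
        by (intro fam.span_base) blast
      moreover have "(\<Sum>j\<in>J. scale_fam (c j) (skyscraper j)) \<in> fam.span (?X \<union> ?B)"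
        by (intro fam.span_sum fam.span_scale fam.span_base) blast
      ultimately have "s - (\<Sum>j\<in>J. scale_fam (c j) (skyscraper j)) +
          (\<Sum>j\<in>J. scale_fam (c j) (skyscraper j)) \<in> fam.span (?X \<union> ?B)"
        by (rule fam.span_add)
      then show "s \<in> fam.span (?X \<union> ?B)"
        by simp
    qed
  qed (use sub fin in simp_all)
  then show ?thesis
    by (simp add: card_image skyscraper_inj J_def)
qed

end

section \<open>Sheaves generated by monomials\<close>

lemma val0_eq_subdegree:
  assumes "has_expansion f h" "f \<noteq> 0"
  shows "val0 f = int (subdegree h)"
proof -
  obtain p q where *: "poly q 0 \<noteq> 0" "f = to_fract p / to_fract q" "fps_of_poly p = h * fps_of_poly q"
    using assms(1) unfolding has_expansion_def by blast
  have nz: "p \<noteq> 0" "q \<noteq> 0"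
    using * assms(2) by auto
  have nz': "fps_of_poly p \<noteq> 0" "fps_of_poly q \<noteq> 0"
    using nz by (metis fps_of_poly_0 fps_of_poly_eq_iff)+
  then have "subdegree (fps_of_poly p) = subdegree h + subdegree (fps_of_poly q)"
    unfolding *(3) by (intro subdegree_mult) auto
  then have sub: "int (order 0 p) - int (order 0 q) = int (subdegree h)"
    using nz by (simp add: subdegree_fps_of_poly)
  show ?thesis
    unfolding val0_def
  proof (rule the_equality)
    show "\<exists>p q. p \<noteq> 0 \<and> q \<noteq> 0 \<and> f = Fract p q \<and> int (subdegree h) = int (order 0 p) - int (order 0 q)"
      using nz *(2) sub by (metis Fract_conv_to_fract)
  next
    \<comment> \<open>Two fractions for f satisfy p * q' = p' * q, and \<open>order 0\<close> is
      additive on products, so the definite description does not depend on the fraction.\<close>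
    fix z assume "\<exists>p q. p \<noteq> 0 \<and> q \<noteq> 0 \<and> f = Fract p q \<and> z = int (order 0 p) - int (order 0 q)"
    then obtain p' q' where z: "p' \<noteq> 0" "q' \<noteq> 0" "f = Fract p' q'"
        "z = int (order 0 p') - int (order 0 q')"
      by blast
    then have "p * q' = p' * q"
      using *(2) nz to_fract_divide_eq_iff[of q q' p p'] by (simp add: Fract_conv_to_fract)
    then have "order 0 p + order 0 q' = order 0 p' + order 0 q"
      using nz z(1,2) by (metis mult_eq_0_iff order_mult)
    then show "z = int (subdegree h)"
      using sub z(4) by linarith
  qed
qed

context monomial_exponents
begin

text \<open>The valuation is the lowest exponent of the expansion, which lies in the support;
  conversely j is the valuation of t^j.\<close>

lemma cusp_semigroup_eq: "cusp_semigroup TYPE('k::field) m e = semigrp"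
proof (rule set_eqI, rule iffI)
  fix j assume "j \<in> cusp_semigroup TYPE('k) m e"
  then obtain f :: "'k poly fract" where f: "f \<in> supp_fun semigrp" "f \<noteq> 0" "val0 f = int j"
    unfolding cusp_semigroup_def cusp_point_eq structure_sheaf_cusp by blast
  then obtain h where h: "has_expansion f h" "\<forall>j. j \<notin> semigrp \<longrightarrow> fps_nth h j = 0"
    unfolding supp_fun_def by blast
  then have j: "j = subdegree h"
    using val0_eq_subdegree[OF h(1) f(2)] f(3) by simp
  have "h \<noteq> 0"
  proof
    assume "h = 0"
    then have "f = 0"
      using h(1) unfolding has_expansion_def by (metis fps_of_poly_0 fps_of_poly_eq_iff div_0 mult_zero_left to_fract_0)
    then show False
      using f(2) by simp
  qed
  then show "j \<in> semigrp"
    using h(2) unfolding j by (metis nth_subdegree_nonzero)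
next
  fix j assume j: "j \<in> semigrp"
  have "val0 (t_pow j :: 'k poly fract) = int j"
    using val0_eq_subdegree[OF has_expansion_t_pow t_pow_nonzero, of j] by simp
  then show "j \<in> cusp_semigroup TYPE('k) m e"
    unfolding cusp_semigroup_def cusp_point_eq structure_sheaf_cusp
    using t_pow_in_supp_fun[OF j] t_pow_nonzero by blast
qed

lemma structure_sheaf_monomial: "monomial_sheaf semigrp 0 (structure_sheaf m e :: 'k::field rsheaf)"
  unfolding monomial_sheaf_def
  by (simp add: structure_sheaf_affine structure_sheaf_cusp structure_sheaf_inf)

section \<open>Stalks of a sheaf generated by monomials\<close>

lemma generated_sheaf_iff:
  "g \<in> generated_sheaf m e (map (\<lambda>i. t_pow (b i)) [0..<Suc n]) R \<longleftrightarrow>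
     (\<exists>u. (\<forall>i\<le>n. u i \<in> structure_sheaf m e R) \<and> g = (\<Sum>i\<le>n. t_pow (b i) * u i))"
proof -
  let ?fs = "map (\<lambda>i. t_pow (b i)) [0..<Suc n]"
  have len: "length ?fs = Suc n"
    by simp
  have nth: "?fs ! i = t_pow (b i)" if "i \<le> n" for i
    using that by (simp del: upt_Suc)
  have "(\<Sum>i<length ?fs. ?fs ! i * u i) = (\<Sum>i\<le>n. t_pow (b i) * u i)" for u
    unfolding len lessThan_Suc_atMost by (intro sum.cong) (simp_all add: nth del: upt_Suc)
  then show ?thesis
    unfolding generated_sheaf_def len less_Suc_eq_le by auto
qed

lemma generated_sheaf_stalk_subspace:
  assumes "R \<in> monomial_curve m e"
  shows "kt.subspace (generated_sheaf m e (map (\<lambda>i. t_pow (b i)) [0..<Suc n]) R :: 'k::field poly fract set)"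
proof (rule kt.subspaceI; (unfold generated_sheaf_iff)?)
  note sub = monomial_sheaf_stalk_subspace[OF structure_sheaf_monomial assms]
  show "\<exists>u. (\<forall>i\<le>n. u i \<in> structure_sheaf m e R) \<and> 0 = (\<Sum>i\<le>n. t_pow (b i) * u i)"
    using kt.subspace_0[OF sub] by (intro exI[of _ "\<lambda>_. 0"]) simp
next
  note sub = monomial_sheaf_stalk_subspace[OF structure_sheaf_monomial assms]
  fix f g assume "\<exists>u. (\<forall>i\<le>n. u i \<in> structure_sheaf m e R) \<and> f = (\<Sum>i\<le>n. t_pow (b i) * u i)"
    "\<exists>u. (\<forall>i\<le>n. u i \<in> structure_sheaf m e R) \<and> g = (\<Sum>i\<le>n. t_pow (b i) * u i)"
  then obtain u v where "\<forall>i\<le>n. u i \<in> structure_sheaf m e R" "f = (\<Sum>i\<le>n. t_pow (b i) * u i)"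
      "\<forall>i\<le>n. v i \<in> structure_sheaf m e R" "g = (\<Sum>i\<le>n. t_pow (b i) * v i)"
    by blast
  then show "\<exists>u. (\<forall>i\<le>n. u i \<in> structure_sheaf m e R) \<and> f + g = (\<Sum>i\<le>n. t_pow (b i) * u i)"
    using kt.subspace_add[OF sub]
    by (intro exI[of _ "\<lambda>i. u i + v i"]) (simp add: sum.distrib distrib_left)
next
  note sub = monomial_sheaf_stalk_subspace[OF structure_sheaf_monomial assms]
  fix c f assume "\<exists>u. (\<forall>i\<le>n. u i \<in> structure_sheaf m e R) \<and> f = (\<Sum>i\<le>n. t_pow (b i) * u i)"
  then obtain u where "\<forall>i\<le>n. u i \<in> structure_sheaf m e R" "f = (\<Sum>i\<le>n. t_pow (b i) * u i)"
    by blast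
  then show "\<exists>u. (\<forall>i\<le>n. u i \<in> structure_sheaf m e R) \<and> scale_kt c f = (\<Sum>i\<le>n. t_pow (b i) * u i)"
    using kt.subspace_scale[OF sub]
    by (intro exI[of _ "\<lambda>i. scale_kt c (u i)"])
      (simp add: scale_kt_def sum_distrib_left mult.left_commute)
qed

lemma generator_multiple_in_generated_sheaf:
  assumes "R \<in> monomial_curve m e" "u \<in> structure_sheaf m e R" "i \<le> n"
  shows "t_pow (b i) * u \<in> generated_sheaf m e (map (\<lambda>i. t_pow (b i)) [0..<Suc n]) R"
proof -
  have "t_pow (b i) * u = (\<Sum>j\<le>n. t_pow (b j) * (if j = i then u else 0))"
    using assms(3) by (simp add: if_distrib[of "\<lambda>x. _ * x"] cong: if_cong)
  moreover have "\<forall>j\<le>n. (if j = i then u else 0) \<in> structure_sheaf m e R"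
    using assms(2) kt.subspace_0[OF monomial_sheaf_stalk_subspace[OF structure_sheaf_monomial assms(1)]]
    by simp
  ultimately show ?thesis
    unfolding generated_sheaf_iff by (intro exI conjI)
qed

text \<open>An expansion supported in D may be infinite, while the stalk consists of finite
  combinations. Beyond the gaps the tail is itself in the local ring, and the finitely many
  remaining terms have exponents b i + s with s in the semigroup.\<close>

lemma generated_sheaf_cusp:
  assumes b0: "b 0 = 0" and D: "D = (\<Union>i\<le>n. (\<lambda>j. b i + j) ` semigrp)"
  shows "generated_sheaf m e (map (\<lambda>i. t_pow (b i)) [0..<Suc n]) (affine_pt m e (0 :: 'k::field)) =
    supp_fun D"
proof (rule set_eqI, rule iffI)
  let ?P = "affine_pt m e (0 :: 'k)"
  fix g assume "g \<in> generated_sheaf m e (map (\<lambda>i. t_pow (b i)) [0..<Suc n]) ?P"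
  then obtain u where u: "\<forall>i\<le>n. u i \<in> supp_fun semigrp" "g = (\<Sum>i\<le>n. t_pow (b i) * u i)"
    unfolding generated_sheaf_iff structure_sheaf_cusp by blast
  have "t_pow (b i) * u i \<in> supp_fun D" if "i \<le> n" for i
    by (rule supp_fun_mult[of _ "{b i}" _ semigrp]) (use that u(1) in \<open>auto simp: D t_pow_in_supp_fun\<close>)
  then show "g \<in> supp_fun D"
    unfolding u(2) by (intro kt.subspace_sum[OF supp_fun_subspace]) simp
next
  let ?P = "affine_pt m e (0 :: 'k)"
  let ?F = "generated_sheaf m e (map (\<lambda>i. t_pow (b i)) [0..<Suc n]) ?P"
  fix g :: "'k poly fract" assume g: "g \<in> supp_fun D"
  have P: "?P \<in> monomial_curve m e"
    by (simp add: monomial_curve_eq)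
  note sub = generated_sheaf_stalk_subspace[OF P, of b n]
  define N where "N = e (m - 1) * e (m - 1)"
  obtain c where c: "g - (\<Sum>j<N. scale_kt (c j) (t_pow j)) \<in> supp_fun {N..}"
      "\<And>j. j \<notin> D \<Longrightarrow> c j = 0"
    using supp_fun_finite_part[OF g, where N = N] by metis
  have "supp_fun {N..} \<subseteq> (supp_fun semigrp :: 'k poly fract set)"
    using semigrp_conductor by (intro supp_fun_mono) (auto simp: N_def)
  \<comment> \<open>The tail is taken as a multiple of the generator t^(b 0) = 1.\<close>
  then have "t_pow (b 0) * (g - (\<Sum>j<N. scale_kt (c j) (t_pow j))) \<in> ?F"
    using c(1) by (intro generator_multiple_in_generated_sheaf P) (auto simp: structure_sheaf_cusp)
  then have tail: "g - (\<Sum>j<N. scale_kt (c j) (t_pow j)) \<in> ?F"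
    by (simp add: b0 t_pow_0)
  have "scale_kt (c j) (t_pow j) \<in> ?F" for j
  proof (cases "j \<in> D")
    case True
    then obtain i s where i: "i \<le> n" "s \<in> semigrp" "j = b i + s"
      unfolding D by blast
    have "t_pow (b i) * t_pow s \<in> ?F"
      using i by (intro generator_multiple_in_generated_sheaf P)
        (simp_all add: structure_sheaf_cusp t_pow_in_supp_fun)
    then show ?thesis
      unfolding i(3) by (intro kt.subspace_scale[OF sub]) (simp add: t_pow_mult)
  next
    case False
    then show ?thesis
      using c(2) kt.subspace_0[OF sub] by simp
  qed
  then have "(\<Sum>j<N. scale_kt (c j) (t_pow j)) \<in> ?F"
    by (intro kt.subspace_sum[OF sub])
  then have "g - (\<Sum>j<N. scale_kt (c j) (t_pow j)) + (\<Sum>j<N. scale_kt (c j) (t_pow j)) \<in> ?F"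
    using tail by (intro kt.subspace_add[OF sub])
  then show "g \<in> ?F"
    by simp
qed

text \<open>Away from 0 and infinity the generator 1 already gives the whole local ring. At infinity
  the generator with the largest exponent, b n, has the highest pole and generates the stalk
  alone.\<close>

lemma generated_sheaf_monomial:
  assumes b0: "b 0 = 0" and bn: "\<And>i. i \<le> n \<Longrightarrow> b i \<le> b n"
    and D: "D = (\<Union>i\<le>n. (\<lambda>j. b i + j) ` semigrp)"
  shows "monomial_sheaf D (b n) (generated_sheaf m e (map (\<lambda>i. t_pow (b i)) [0..<Suc n]) :: 'k::field rsheaf)"
proof -
  let ?F = "generated_sheaf m e (map (\<lambda>i. t_pow (b i)) [0..<Suc n]) :: 'k rsheaf"
  have "?F (affine_pt m e t) = {f. regular_at t f}" if t: "t \<noteq> 0" for t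
  proof (rule set_eqI, rule iffI)
    fix g assume "g \<in> ?F (affine_pt m e t)"
    then obtain u where u: "\<forall>i\<le>n. regular_at t (u i)" "g = (\<Sum>i\<le>n. t_pow (b i) * u i)"
      unfolding generated_sheaf_iff structure_sheaf_affine[OF t] by blast
    then show "g \<in> {f. regular_at t f}"
      unfolding u(2) by (intro kt.subspace_sum[OF regular_at_subspace])
        (simp add: regular_at_mult regular_at_t_pow)
  next
    fix g assume "g \<in> {f. regular_at t f}"
    then have "t_pow (b 0) * g \<in> ?F (affine_pt m e t)"
      by (intro generator_multiple_in_generated_sheaf)
        (simp_all add: structure_sheaf_affine[OF t] monomial_curve_eq)
    then show "g \<in> ?F (affine_pt m e t)"
      by (simp add: b0 t_pow_0)
  qed
  moreover have "?F (inf_pt m) = {f. pole_inf_le (b n) f}"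
  proof (rule set_eqI, rule iffI)
    fix g assume "g \<in> ?F (inf_pt m)"
    then obtain u where u: "\<forall>i\<le>n. pole_inf_le 0 (u i)" "g = (\<Sum>i\<le>n. t_pow (b i) * u i)"
      unfolding generated_sheaf_iff structure_sheaf_inf by blast
    have "pole_inf_le (b n) (t_pow (b i) * u i)" if "i \<le> n" for i
      using pole_inf_le_mult[OF pole_inf_le_t_pow[OF bn[OF that]], of 0 "u i"] u(1) that by simp
    then show "g \<in> {f. pole_inf_le (b n) f}"
      unfolding u(2) by (intro kt.subspace_sum[OF pole_inf_le_subspace]) simp
  next
    fix g :: "'k poly fract" assume "g \<in> {f. pole_inf_le (b n) f}"
    then have "t_pow (b n) * (g / t_pow (b n)) \<in> ?F (inf_pt m)"
      by (intro generator_multiple_in_generated_sheaf)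
        (simp_all add: structure_sheaf_inf monomial_curve_eq pole_inf_le_divide_t_pow)
    then show "g \<in> ?F (inf_pt m)"
      by (simp add: t_pow_nonzero)
  qed
  ultimately show ?thesis
    unfolding monomial_sheaf_def using generated_sheaf_cusp[OF b0 D] by blast
qed

text \<open>If f generates the stalk at the cusp, then 1 = f * u with u in the local ring. For j in
  D, t^j is also a multiple f * w, so w = u * t^j. As f is regular at 0, u has a nonzero constant
  term; the expansion of w thus has a nonzero coefficient at j, and w lies in the local
  ring.\<close>

lemma invertible_monomial_sheaf_support:
  fixes \<F> :: "'k::field rsheaf"
  assumes F: "monomial_sheaf D N \<F>" and D: "0 \<in> D" and inv: "invertible_sheaf m e \<F>"
  shows "D \<subseteq> semigrp"
proof
  fix j assume j: "j \<in> D"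
  have "affine_pt m e (0 :: 'k) \<in> monomial_curve m e"
    by (simp add: monomial_curve_eq)
  then obtain f where "\<F> (affine_pt m e 0) = (\<lambda>u. f * u) ` structure_sheaf m e (affine_pt m e 0)"
    using inv unfolding invertible_sheaf_def by blast
  then have f: "supp_fun D = (\<lambda>u. f * u) ` supp_fun semigrp"
    using F by (simp add: monomial_sheaf_def structure_sheaf_cusp)
  have "1 \<in> (supp_fun semigrp :: 'k poly fract set)" "1 \<in> (supp_fun D :: 'k poly fract set)"
    using t_pow_in_supp_fun[OF semigrp_0] t_pow_in_supp_fun[OF D] by (simp_all add: t_pow_0)
  then obtain u where "f \<in> supp_fun D" "u \<in> supp_fun semigrp" "1 = f * u"
    unfolding f by (metis (no_types, lifting) image_iff mult.right_neutral)
  then obtain h h' where h: "has_expansion f h" "has_expansion u h'"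
    unfolding supp_fun_def by blast
  have hh: "h * h' = 1"
    using has_expansion_unique[OF has_expansion_mult[OF h]] has_expansion_1 \<open>1 = f * u\<close> by metis
  have "t_pow j \<in> (\<lambda>u. f * u) ` supp_fun semigrp"
    unfolding f[symmetric] using j by (rule t_pow_in_supp_fun)
  then obtain w where w: "w \<in> supp_fun semigrp" "t_pow j = f * w"
    by blast
  then obtain k where k: "has_expansion w k" "\<forall>j. j \<notin> semigrp \<longrightarrow> fps_nth k j = 0"
    unfolding supp_fun_def by blast
  have "h * k = fps_X ^ j"
    using has_expansion_unique[OF has_expansion_mult[OF h(1) k(1)]] has_expansion_t_pow w(2) by metis
  then have "h' * (h * k) = h' * fps_X ^ j"
    by simp
  then have "k = h' * fps_X ^ j"
    using hh by (metis mult.assoc mult.commute mult_1)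
  then have "fps_nth k j = fps_nth h' 0"
    by (simp add: fps_X_power_mult_right_nth)
  moreover have "fps_nth h 0 * fps_nth h' 0 = 1"
    using arg_cong[OF hh, of "\<lambda>h. fps_nth h 0"] by simp
  ultimately show "j \<in> semigrp"
    using k(2) by fastforce
qed

end

section \<open>The Clifford index\<close>

text \<open>Let A, B, C count the elements of S, of E - S and of the remaining gaps in [1, N], and
  let Y and X count E - S and the remaining gaps beyond N. The first sheaf has h0 = 1 + A + B and h1
  = X, the structure sheaf has h0 = 1 and h1 = B + C + X + Y. So the degree is A + 2 * B + C + Y,
  and subtracting 2 * (A + B) leaves C - A + Y: the count B cancels.\<close>

lemma gap_count:
  fixes S E :: "nat set"
  assumes fin: "finite (- S)" and S0: "0 \<in> S"
  shows "int (card ((S \<union> E) \<inter> {..N})) - int (card ({N<..} - (S \<union> E)))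
      - (int (card (S \<inter> {..0})) - int (card ({0<..} - S))) - 2 * (int (card ((S \<union> E) \<inter> {..N})) - 1) =
    int (card ((- S - E) \<inter> {1..N})) - int (card (S \<inter> {1..N})) + int (card ((E - S) \<inter> {N<..}))"
proof -
  have 1: "card ((S \<union> E) \<inter> {..N}) = Suc (card (S \<inter> {1..N}) + card ((E - S) \<inter> {1..N}))"
  proof -
    have "(S \<union> E) \<inter> {..N} = insert 0 (S \<inter> {1..N} \<union> (E - S) \<inter> {1..N})"
      using S0 by (auto simp: Suc_le_eq)
    moreover have "card (S \<inter> {1..N} \<union> (E - S) \<inter> {1..N}) = card (S \<inter> {1..N}) + card ((E - S) \<inter> {1..N})"
      by (rule card_Un_disjoint) auto
    ultimately show ?thesis
      by simp
  qed
  have 2: "card ({0<..} - S) = card ((- S - E) \<inter> {1..N}) + card ((E - S) \<inter> {1..N}) +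
      (card ({N<..} - (S \<union> E)) + card ((E - S) \<inter> {N<..}))"
  proof -
    have fin': "finite A" if "A \<subseteq> - S" for A
      using fin that by (rule rev_finite_subset)
    have "{0<..} - S = ((- S - E) \<inter> {1..N} \<union> (E - S) \<inter> {1..N}) \<union>
        (({N<..} - (S \<union> E)) \<union> (E - S) \<inter> {N<..})"
      by auto
    also have "card \<dots> = card ((- S - E) \<inter> {1..N} \<union> (E - S) \<inter> {1..N}) +
        card (({N<..} - (S \<union> E)) \<union> (E - S) \<inter> {N<..})"
      by (rule card_Un_disjoint) (auto intro: fin')
    also have "card ((- S - E) \<inter> {1..N} \<union> (E - S) \<inter> {1..N}) =
        card ((- S - E) \<inter> {1..N}) + card ((E - S) \<inter> {1..N})"
      by (rule card_Un_disjoint) auto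
    also have "card (({N<..} - (S \<union> E)) \<union> (E - S) \<inter> {N<..}) =
        card ({N<..} - (S \<union> E)) + card ((E - S) \<inter> {N<..})"
      by (rule card_Un_disjoint) (auto intro: fin')
    finally show ?thesis .
  qed
  have 3: "S \<inter> {..0} = {0}"
    using S0 by auto
  show ?thesis
    unfolding 1 2 3 by simp
qed

theorem mainTheorem5:
  fixes m n \<gamma> :: nat and e a :: "nat \<Rightarrow> nat"
    and \<F> :: "'k::alg_closed_field rsheaf"
    and S G E :: "nat set"
  assumes "unicuspidal_monomial_curve TYPE('k) m e"
    and "arithmetic_genus TYPE('k) m e \<ge> 4"
    and "S = cusp_semigroup TYPE('k) m e"
    and "G = gaps S"
    and "\<gamma> = frobenius_number S"
    and "n \<ge> 1"
    and "0 < a 1"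
    and "strict_mono_on {1..n} a"
    and "\<F> = generated_sheaf m e (1 # map (\<lambda>i. t_pow (a i)) [1..<n + 1])"
    and "E = (\<Union>i\<in>{1..n}. (\<lambda>j. a i + j) ` S)"
  shows "clifford_index m e \<F> =
           int (card ((G - E) \<inter> {1..a n})) - int (card (S \<inter> {1..a n}))
             + int (card ((E - S) \<inter> {a n + 1..\<gamma>}))
         \<and> (invertible_sheaf m e \<F> \<longrightarrow>
             clifford_index m e \<F> = int (card (G \<inter> {1..a n})) - int (card (S \<inter> {1..a n})))"
proof -
  interpret monomial_exponents m e
    using assms(1) unfolding unicuspidal_monomial_curve_def by unfold_locales blast+
  have S: "S = semigrp"
    unfolding assms(3) by (rule cusp_semigroup_eq)
  \<comment> \<open>The index 0 with exponent 0 stands for the generator 1, so that the generators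
    are powers of t indexed uniformly by 0, ..., n. It also contributes S itself to the
    support.\<close>
  define b where "b i = (if i = 0 then 0 else a i)" for i
  have bn: "b n = a n"
    using assms(6) by (simp add: b_def)
  have "1 # map (\<lambda>i. t_pow (a i)) [1..<n + 1] = map (\<lambda>i. t_pow (b i)) [0..<Suc n]"
    by (simp add: b_def t_pow_0 upt_conv_Cons del: upt_Suc)
  then have \<F>: "\<F> = generated_sheaf m e (map (\<lambda>i. t_pow (b i)) [0..<Suc n])"
    using assms(9) by metis
  have D: "S \<union> E = (\<Union>i\<le>n. (\<lambda>j. b i + j) ` semigrp)"
  proof -
    have "{..n} = insert 0 {1..n}"
      by auto
    then show ?thesis
      unfolding assms(10) S by (simp add: b_def)
  qed
  have "b i \<le> b n" if "i \<le> n" for i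
    using that strict_mono_onD[OF assms(8), of i n] by (cases "i = n") (auto simp: b_def)
  then have F: "monomial_sheaf (S \<union> E) (a n) \<F>"
    unfolding \<F> bn[symmetric] by (intro generated_sheaf_monomial D) (simp_all add: b_def)
  define C where "C = e (m - 1) * e (m - 1)"
  have C: "{C..} \<subseteq> S"
    using semigrp_conductor by (auto simp: C_def S)
  have fin: "finite (- S)"
    by (rule finite_subset[of _ "{..<C}"]) (use C in \<open>auto simp: not_le[symmetric]\<close>)
  have h: "h0 m e \<F> = card ((S \<union> E) \<inter> {..a n})" "h1 m e \<F> = card ({a n<..} - (S \<union> E))"
    using h0_monomial_sheaf[OF F] h1_monomial_sheaf[OF F] C by blast+
  have hO: "h0 m e (structure_sheaf m e :: 'k rsheaf) = card (S \<inter> {..0})"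
      "h1 m e (structure_sheaf m e :: 'k rsheaf) = card ({0<..} - S)"
    using h0_monomial_sheaf[OF structure_sheaf_monomial] h1_monomial_sheaf[OF structure_sheaf_monomial] C
    unfolding S by blast+
  \<comment> \<open>Elements of E - S are gaps, hence at most the Frobenius number; the cutoff at
    \<open>\<gamma>\<close> loses nothing.\<close>
  have "(E - S) \<inter> {a n<..} = (E - S) \<inter> {a n + 1..\<gamma>}"
    using Max_ge[OF fin] by (auto simp: assms(5) frobenius_number_def gaps_def Compl_eq_Diff_UNIV)
  then have main: "clifford_index m e \<F> =
      int (card ((G - E) \<inter> {1..a n})) - int (card (S \<inter> {1..a n})) + int (card ((E - S) \<inter> {a n + 1..\<gamma>}))"
    using gap_count[OF fin, of E "a n"] semigrp_0
    by (simp add: clifford_index_def sheaf_degree_def euler_char_def h hO S assms(4) gaps_def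
        Compl_eq_Diff_UNIV)
  moreover have "E \<subseteq> S" if "invertible_sheaf m e \<F>"
    using invertible_monomial_sheaf_support[OF F _ that] semigrp_0 by (simp add: S)
  moreover have "G - E = G" "E - S = {}" if "E \<subseteq> S"
    using that by (auto simp: assms(4) gaps_def)
  ultimately show ?thesis
    by fastforce
qed

end
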